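(* For $k\ge1$ consider the permutations $$w_k^-=(2,4,\dots,2k,2k-1,2k-3,\dots,3,1)\in\mathbb{S}_{2k},\qquad w_k^+=(2,4,\dots,2k,2k+1,2k-1,\dots,3,1)\in\mathbb{S}_{2k+1}$$ (in one-line notation). Then $$\mathfrak{S}_{w_k^-}(1)=\mathrm{CSTCPP}(k),\qquad\mathfrak{S}_{w_k^+}(1)=\mathrm{VSASM}(k),$$ where $\mathfrak{S}_w(1)$ denotes the value of the Schubert polynomial $\mathfrak{S}_w$ at $x_1=x_2=\cdots=1$.
   Context: $\mathrm{VSASM}(n)$ is the number of alternating sign $(2n+1)\times(2n+1)$ matrices symmetric about the vertical axis, $$\mathrm{VSASM}(n)=\prod_{j=1}^{n-1}\frac{(3j+2)(6j+3)!\,(2j+1)!}{(4j+2)!\,(4j+3)!},$$ and $\mathrm{CSTCPP}(n)$ is the number of cyclically symmetric transpose complement plane partitions, given by $$\mathrm{CSTCPP}(n)=\prod_{j=1}^{n-1}\frac{(3j+1)(6j)!\,(2j)!}{(4j+1)!\,(4j)!}.$$ Schubert polynomials are the standard ones of Lascoux–Schützenberger ($\mathfrak{S}_{w_0}=x_1^{n-1}x_2^{n-2}\cdots x_{n-1}$ for the longest $w_0\in\mathbb{S}_n$, and $\mathfrak{S}_{ws_i}=\partial_i\mathfrak{S}_w$ if $\ell(ws_i)=\ell(w)-1$). *)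

theory Defs
  imports
    Complex_Main
    "HOL-Library.Poly_Mapping"
    "HOL-Combinatorics.Transposition"
begin

text \<open>
  Multivariate polynomials over \<open>\<int>\<close> in the variables \<open>x\<^sub>0, x\<^sub>1, x\<^sub>2, \<dots>\<close>: finitely supported
  maps from exponent vectors to coefficients, with the convolution product of
  \<^theory>\<open>HOL-Library.Poly_Mapping\<close>. The variable \<open>x\<^sub>0\<close> never occurs below.
\<close>

type_synonym int_mpoly = "(nat \<Rightarrow>\<^sub>0 nat) \<Rightarrow>\<^sub>0 int"

definition Var :: "nat \<Rightarrow> int_mpoly" where
  "Var i = Poly_Mapping.single (Poly_Mapping.single i 1) 1"

definition poly_subst :: "(nat \<Rightarrow> 'a::comm_ring_1) \<Rightarrow> int_mpoly \<Rightarrow> 'a" where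
  "poly_subst \<sigma> f =
    (\<Sum>m\<in>Poly_Mapping.keys f. of_int (Poly_Mapping.lookup f m) *
      (\<Prod>i\<in>Poly_Mapping.keys m. \<sigma> i ^ Poly_Mapping.lookup m i))"

text \<open>
  The divided difference \<open>\<partial>\<^sub>i f = (f - s\<^sub>i f) / (x\<^sub>i - x\<^sub>i\<^sub>+\<^sub>1)\<close>, where \<open>s\<^sub>i\<close> exchanges the variables
  \<open>x\<^sub>i\<close> and \<open>x\<^sub>i\<^sub>+\<^sub>1\<close>. The division is always exact, and the quotient is unique because
  polynomials form an integral domain.
\<close>

definition divided_difference :: "nat \<Rightarrow> int_mpoly \<Rightarrow> int_mpoly" where
  "divided_difference i f =
    (THE g. (Var i - Var (Suc i)) * g = f - poly_subst (Var \<circ> transpose i (Suc i)) f)"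

text \<open>
  A permutation in \<open>\<S>\<^sub>n\<close> is a function on \<^typ>\<open>nat\<close> that permutes \<open>{1..n}\<close> and fixes every other
  number; its one-line notation is the list of its values at \<open>1, \<dots>, n\<close>. In this
  representation \<open>w s\<^sub>i\<close> is \<open>w \<circ> transpose i (Suc i)\<close>.
\<close>

definition one_line :: "nat list \<Rightarrow> nat \<Rightarrow> nat" where
  "one_line xs i = (if 1 \<le> i \<and> i \<le> length xs then xs ! (i - 1) else i)"

definition perm_length :: "(nat \<Rightarrow> nat) \<Rightarrow> nat" where
  "perm_length w = card {(i, j). i < j \<and> w j < w i}"

definition longest_perm :: "nat \<Rightarrow> nat \<Rightarrow> nat" where
  "longest_perm n = one_line (rev [1..<Suc n])"

text \<open>
  \<open>is_schubert n w f\<close> holds if \<open>f\<close> arises as the polynomial of \<open>w\<close> by descending from the longest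
  element of \<open>\<S>\<^sub>n\<close> along some chain of length-decreasing right multiplications by simple
  transpositions. By the braid relations for divided differences, every \<open>w \<in> \<S>\<^sub>n\<close> has exactly
  one such \<open>f\<close>; this is the Schubert polynomial.
\<close>

inductive is_schubert :: "nat \<Rightarrow> (nat \<Rightarrow> nat) \<Rightarrow> int_mpoly \<Rightarrow> bool" for n where
  longest: "is_schubert n (longest_perm n) (\<Prod>i = 1..n. Var i ^ (n - i))"
| descend: "is_schubert n w f \<Longrightarrow> 1 \<le> i \<Longrightarrow> i < n \<Longrightarrow>
    perm_length (w \<circ> transpose i (Suc i)) + 1 = perm_length w \<Longrightarrow>
    is_schubert n (w \<circ> transpose i (Suc i)) (divided_difference i f)"

definition schubert :: "nat \<Rightarrow> (nat \<Rightarrow> nat) \<Rightarrow> int_mpoly" where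
  "schubert n w = (THE f. is_schubert n w f)"

definition w_minus :: "nat \<Rightarrow> nat \<Rightarrow> nat" where
  "w_minus k = one_line (map (\<lambda>j. 2 * j) [1..<Suc k] @ rev (map (\<lambda>j. 2 * j + 1) [0..<k]))"

definition w_plus :: "nat \<Rightarrow> nat \<Rightarrow> nat" where
  "w_plus k = one_line (map (\<lambda>j. 2 * j) [1..<Suc k] @ rev (map (\<lambda>j. 2 * j + 1) [0..<Suc k]))"

text \<open>
  The product formulas for the number of vertically symmetric alternating sign matrices of
  size \<open>(2n+1) \<times> (2n+1)\<close> and of cyclically symmetric transpose complement plane partitions.
  The individual factors need not be integers, so the products are taken in \<open>\<rat>\<close>.
\<close>

definition VSASM :: "nat \<Rightarrow> rat" where
  "VSASM n = (\<Prod>j = 1..<n.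
     (of_nat (3 * j + 2) * fact (6 * j + 3) * fact (2 * j + 1)) /
     (fact (4 * j + 2) * fact (4 * j + 3)))"

definition CSTCPP :: "nat \<Rightarrow> rat" where
  "CSTCPP n = (\<Prod>j = 1..<n.
     (of_nat (3 * j + 1) * fact (6 * j) * fact (2 * j)) /
     (fact (4 * j + 1) * fact (4 * j)))"

end

theory Submission
  imports Defs "Jordan_Normal_Form.Determinant" "HOL-Computational_Algebra.Formal_Power_Series"
begin

text \<open>
  Both families are treated at once. For every \<open>n\<close> let \<open>w\<^sub>n\<close> be the permutation of \<open>{1..n}\<close> that lists
  the even numbers in increasing order and then the odd ones in decreasing order, so that
  \<open>w\<^sub>2\<^sub>k\<close> and \<open>w\<^sub>2\<^sub>k\<^sub>+\<^sub>1\<close> are the permutations in question. The value of its Schubert polynomial at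
  \<open>(1, 1, \<dots>)\<close> is computed as a product of \<open>n\<close> pivots that do not depend on \<open>n\<close>.

  The Schubert polynomial is a flagged determinant of complete homogeneous polynomials. For the
  longest permutation this holds because \<open>x\<^sub>1\<^sup>n\<^sup>-\<^sup>1 x\<^sub>2\<^sup>n\<^sup>-\<^sup>2 \<dots>\<close> is such a determinant
  (\<open>flagged_det_longest\<close>). A divided difference that touches a single row only changes the indices in
  that row (\<open>divided_difference_flagged_det\<close>). The permutation \<open>w\<^sub>n\<close> is reached from the longest one by
  a chain of such steps, in which the entries \<open>1, 2, 3, \<dots>\<close> move to their places one after the other
  (\<open>is_schubert_chain\<close>). Any chain may be used, because the polynomial is unique
  (\<open>is_schubert_unique\<close>, from the braid relations).

  At \<open>x\<^sub>1 = x\<^sub>2 = \<dots> = 1\<close> unitriangular column operations turn the determinant into the one whose rows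
  \<open>s = 0, \<dots>, n - 1\<close> are the coefficients of \<open>t\<^sup>a (1 + t)\<^sup>s\<close> with \<open>a = \<lceil>s/2\<rceil>\<close> (\<open>flagged_det_one\<close>). With
  \<open>y = t (1 + t)\<^sup>2\<close> these are the polynomials \<open>y\<^sup>p\<close> and \<open>t (1 + t) y\<^sup>p\<close>. Further column operations
  amount to expanding \<open>(1 + t) f dt/dy\<close> instead of \<open>f\<close>, in powers of \<open>y\<close> (\<open>det_unimodal_row\<close>).
  The first two rows become the hypergeometric series \<open>F\<^sub>0\<close> and \<open>y F\<^sub>1\<close> with
  \<open>F\<^sub>0 = \<^sub>2F\<^sub>1(1/3, 2/3; 1/2; - 27 y / 4)\<close> and \<open>F\<^sub>1 = \<^sub>2F\<^sub>1(2/3, 4/3; 3/2; - 27 y / 4)\<close>, and the later rows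
  are their multiples by powers of \<open>y\<close>. The contiguous relations of Gauss,
  \<open>F\<^sub>i\<^sub>+\<^sub>1 - F\<^sub>i = c\<^sub>i y F\<^sub>i\<^sub>+\<^sub>2\<close>, act as row operations that replace the rows by \<open>y\<^sup>i F\<^sub>i\<close>, which form an upper
  unitriangular matrix (\<open>hypergeo_row_rec\<close>, \<open>det_twisted_row\<close>). The pivots \<open>m\<^sub>i\<close> satisfy \<open>m\<^sub>0 = m\<^sub>1 = 1\<close> and
  \<open>m\<^sub>i\<^sub>+\<^sub>2 = - c\<^sub>i m\<^sub>i\<close>, and the products \<open>m\<^sub>2\<^sub>j m\<^sub>2\<^sub>j\<^sub>+\<^sub>1\<close> and \<open>m\<^sub>2\<^sub>j\<^sub>+\<^sub>1 m\<^sub>2\<^sub>j\<^sub>+\<^sub>2\<close> are the factors of the two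
  product formulas.
\<close>

section \<open>Substitution into integer polynomials\<close>

text \<open>The value of the monomial with exponent vector \<open>m\<close> at the point \<open>\<sigma>\<close>.\<close>

definition monom_subst :: "(nat \<Rightarrow> 'a::comm_ring_1) \<Rightarrow> (nat \<Rightarrow>\<^sub>0 nat) \<Rightarrow> 'a" where
  "monom_subst \<sigma> m = (\<Prod>i\<in>Poly_Mapping.keys m. \<sigma> i ^ Poly_Mapping.lookup m i)"

lemma monom_subst_superset:
  assumes "finite K" "Poly_Mapping.keys m \<subseteq> K"
  shows "monom_subst \<sigma> m = (\<Prod>i\<in>K. \<sigma> i ^ Poly_Mapping.lookup m i)"
  unfolding monom_subst_def using assms
  by (intro prod.mono_neutral_left) (auto simp: in_keys_iff)

lemma monom_subst_add: "monom_subst \<sigma> (m + m') = monom_subst \<sigma> m * monom_subst \<sigma> m'"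
proof -
  let ?K = "Poly_Mapping.keys m \<union> Poly_Mapping.keys m'"
  have "Poly_Mapping.keys (m + m') \<subseteq> ?K"
    by (rule Poly_Mapping.keys_add)
  then show ?thesis
    by (simp add: monom_subst_superset[of ?K] lookup_add power_add prod.distrib)
qed

lemma poly_subst_superset:
  assumes "finite K" "Poly_Mapping.keys f \<subseteq> K"
  shows "poly_subst \<sigma> f = (\<Sum>m\<in>K. of_int (Poly_Mapping.lookup f m) * monom_subst \<sigma> m)"
  unfolding poly_subst_def monom_subst_def using assms
  by (intro sum.mono_neutral_left) (auto simp: in_keys_iff)

lemma poly_subst_single: "poly_subst \<sigma> (Poly_Mapping.single m c) = of_int c * monom_subst \<sigma> m"
  by (subst poly_subst_superset[of "{m}"]) auto

lemma poly_subst_0 [simp]: "poly_subst \<sigma> 0 = 0"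
  by (simp add: poly_subst_def)

lemma poly_subst_add: "poly_subst \<sigma> (f + g) = poly_subst \<sigma> f + poly_subst \<sigma> g"
proof -
  let ?K = "Poly_Mapping.keys f \<union> Poly_Mapping.keys g"
  have "Poly_Mapping.keys (f + g) \<subseteq> ?K"
    by (rule Poly_Mapping.keys_add)
  then show ?thesis
    by (simp add: poly_subst_superset[of ?K] lookup_add algebra_simps sum.distrib)
qed

lemma poly_subst_sum: "poly_subst \<sigma> (sum f A) = (\<Sum>a\<in>A. poly_subst \<sigma> (f a))"
  by (induction A rule: infinite_finite_induct) (simp_all add: poly_subst_add)

lemma sum_single_lookup:
  "f = (\<Sum>m\<in>Poly_Mapping.keys f. Poly_Mapping.single m (Poly_Mapping.lookup f m))"
  by (rule poly_mapping_eqI)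
    (auto simp: lookup_sum lookup_single when_def in_keys_iff)

lemma poly_subst_mult: "poly_subst \<sigma> (f * g) = poly_subst \<sigma> f * poly_subst \<sigma> g"
proof -
  have "f * g = (\<Sum>m\<in>Poly_Mapping.keys f. \<Sum>m'\<in>Poly_Mapping.keys g.
     Poly_Mapping.single (m + m') (Poly_Mapping.lookup f m * Poly_Mapping.lookup g m'))"
    by (subst (1) sum_single_lookup[of f], subst (1) sum_single_lookup[of g])
      (simp add: sum_product Poly_Mapping.mult_single)
  then show ?thesis
    by (simp add: poly_subst_sum poly_subst_single monom_subst_add
        poly_subst_superset[of "Poly_Mapping.keys f" f] poly_subst_superset[of "Poly_Mapping.keys g" g]
        sum_product algebra_simps)
qed

lemma poly_subst_1 [simp]: "poly_subst \<sigma> 1 = 1"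
  using poly_subst_single[of \<sigma> 0 1] by (simp add: monom_subst_def)

lemma poly_subst_Var [simp]: "poly_subst \<sigma> (Var i) = \<sigma> i"
  by (simp add: Var_def poly_subst_single monom_subst_def)

lemma comm_ring_hom_poly_subst: "comm_ring_hom (poly_subst \<sigma>)"
  by unfold_locales (simp_all add: poly_subst_add poly_subst_mult)

interpretation poly_subst: comm_ring_hom "poly_subst \<sigma>" for \<sigma> :: "nat \<Rightarrow> 'a::comm_ring_1"
  by (rule comm_ring_hom_poly_subst)

lemma poly_subst_poly_subst:
  "poly_subst \<sigma> (poly_subst \<tau> f) = poly_subst (\<lambda>i. poly_subst \<sigma> (\<tau> i)) f"
  by (simp add: poly_subst_def[of \<tau>] poly_subst_def[of "\<lambda>i. poly_subst \<sigma> (\<tau> i)"]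
      poly_subst.hom_sum poly_subst.hom_prod poly_subst.hom_mult poly_subst.hom_power
      poly_subst.hom_of_int)

lemma Var_power: "Var i ^ k = Poly_Mapping.single (Poly_Mapping.single i k) 1"
proof (induction k)
  case (Suc k)
  have "Var i ^ Suc k = Poly_Mapping.single (Poly_Mapping.single i 1) 1 * Poly_Mapping.single (Poly_Mapping.single i k) 1"
    using Suc by (simp add: Var_def)
  also have "\<dots> = Poly_Mapping.single (Poly_Mapping.single i 1 + Poly_Mapping.single i k) 1"
    by (subst Poly_Mapping.mult_single) simp
  finally show ?case by (simp add: single_add[symmetric])
qed auto

lemma prod_single_1:
  "finite A \<Longrightarrow> (\<Prod>i\<in>A. Poly_Mapping.single (g i) (1::int)) = Poly_Mapping.single (\<Sum>i\<in>A. g i :: nat \<Rightarrow>\<^sub>0 nat) 1"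
  by (induction A rule: finite_induct) (auto simp: Poly_Mapping.mult_single)

lemma monom_subst_Var: "monom_subst Var m = Poly_Mapping.single m 1"
  unfolding monom_subst_def Var_power using sum_single_lookup[of m]
  by (simp add: prod_single_1)

text \<open>Together with \<open>poly_subst_def\<close> this is the expansion of a polynomial into monomials in the
  variables, so that properties of substitutions can be checked on that expansion.\<close>

lemma poly_subst_Var_id: "poly_subst Var f = f"
proof -
  have *: "of_int c * Poly_Mapping.single m 1 = Poly_Mapping.single m c" for c and m :: "nat \<Rightarrow>\<^sub>0 nat"
    using Poly_Mapping.mult_single[of 0 c m 1] by (simp add: single_of_int[symmetric])
  show ?thesis
    by (subst (2) sum_single_lookup[of f])
      (simp add: poly_subst_superset[of "Poly_Mapping.keys f" f] monom_subst_Var *)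
qed

lemma dvd_diff_mult:
  fixes d :: "'a::comm_ring_1"
  assumes "d dvd a - a'" "d dvd b - b'"
  shows "d dvd a * b - a' * b'"
proof -
  have "a * b - a' * b' = (a - a') * b + a' * (b - b')"
    by (simp add: algebra_simps)
  with assms show ?thesis by (metis dvd_add dvd_mult dvd_mult2)
qed

lemma dvd_diff_power:
  fixes d :: "'a::comm_ring_1"
  assumes "d dvd a - a'"
  shows "d dvd a ^ k - a' ^ k"
  by (induction k) (auto intro: dvd_diff_mult assms)

lemma dvd_diff_prod:
  fixes d :: "'a::comm_ring_1"
  assumes "\<And>i. d dvd f i - g i"
  shows "d dvd prod f A - prod g A"
  by (induction A rule: infinite_finite_induct) (auto intro: dvd_diff_mult assms)

text \<open>Substitutions that agree modulo \<open>d\<close> have results that agree modulo \<open>d\<close>. For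
  \<open>\<sigma>\<close> the identity, \<open>\<tau>\<close> the exchange of \<open>x\<^sub>i\<close> and \<open>x\<^sub>i\<^sub>+\<^sub>1\<close> and \<open>d = x\<^sub>i - x\<^sub>i\<^sub>+\<^sub>1\<close> this is the
  exactness of the division in the divided difference.\<close>

lemma dvd_poly_subst_diff:
  assumes "\<And>i. d dvd \<sigma> i - \<tau> i"
  shows "d dvd poly_subst \<sigma> f - poly_subst \<tau> f"
  unfolding poly_subst_def sum_subtractf[symmetric]
  by (intro dvd_sum) (auto intro!: dvd_diff_mult dvd_diff_prod dvd_diff_power assms)

section \<open>Divided differences\<close>

text \<open>The action of the simple transposition \<open>s\<^sub>i\<close> on polynomials.\<close>

definition swap_vars :: "nat \<Rightarrow> int_mpoly \<Rightarrow> int_mpoly" where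
  "swap_vars i = poly_subst (Var \<circ> transpose i (Suc i))"

interpretation swap_vars: comm_ring_hom "swap_vars i" for i
  unfolding swap_vars_def by (rule comm_ring_hom_poly_subst)

lemma swap_vars_Var: "swap_vars i (Var j) = Var (transpose i (Suc i) j)"
  by (simp add: swap_vars_def)

lemma swap_vars_comp:
  "swap_vars i (poly_subst (Var \<circ> p) f) = poly_subst (Var \<circ> (transpose i (Suc i) \<circ> p)) f"
  by (simp add: swap_vars_def poly_subst_poly_subst comp_def)

lemma Var_eq_iff [simp]: "Var i = Var j \<longleftrightarrow> i = j"
proof
  assume "Var i = Var j"
  then have "Poly_Mapping.keys (Var i) = Poly_Mapping.keys (Var j)" by simp
  then have "Poly_Mapping.single i (1 :: nat) = Poly_Mapping.single j 1"
    by (simp add: Var_def)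
  then have "Poly_Mapping.keys (Poly_Mapping.single i (1 :: nat)) = Poly_Mapping.keys (Poly_Mapping.single j (1 :: nat))"
    by simp
  then show "i = j" by simp
qed simp

lemma swap_vars_involutive [simp]: "swap_vars i (swap_vars i f) = f"
proof -
  have "swap_vars i (swap_vars i f) = poly_subst (Var \<circ> (transpose i (Suc i) \<circ> transpose i (Suc i))) f"
    by (subst (2) swap_vars_def) (rule swap_vars_comp)
  then show ?thesis by (simp add: poly_subst_Var_id)
qed

lemma swap_vars_commute:
  assumes "Suc i < j"
  shows "swap_vars i (swap_vars j f) = swap_vars j (swap_vars i f)"
proof -
  have "transpose i (Suc i) \<circ> transpose j (Suc j) = transpose j (Suc j) \<circ> transpose i (Suc i)"
    using assms by (auto simp: fun_eq_iff transpose_def)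
  then show ?thesis
    by (metis swap_vars_comp swap_vars_def)
qed

lemma swap_vars_braid:
  "swap_vars i (swap_vars (Suc i) (swap_vars i f)) = swap_vars (Suc i) (swap_vars i (swap_vars (Suc i) f))"
proof -
  have "transpose i (Suc i) \<circ> (transpose (Suc i) (Suc (Suc i)) \<circ> transpose i (Suc i))
     = transpose (Suc i) (Suc (Suc i)) \<circ> (transpose i (Suc i) \<circ> transpose (Suc i) (Suc (Suc i)))"
    by (auto simp: fun_eq_iff transpose_def)
  then show ?thesis
    by (metis swap_vars_comp swap_vars_def)
qed

lemma divided_difference_spec:
  "(Var i - Var (Suc i)) * divided_difference i f = f - swap_vars i f"
proof -
  have "(Var i - Var (Suc i)) dvd poly_subst Var f - swap_vars i f"
    unfolding swap_vars_def
  proof (rule dvd_poly_subst_diff)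
    fix j
    have *: "Var i - Var (Suc i) dvd Var (Suc i) - Var i"
      by (metis dvd_minus_iff dvd_refl minus_diff_eq)
    show "Var i - Var (Suc i) dvd Var j - (Var \<circ> transpose i (Suc i)) j"
      using * by (auto simp: transpose_def)
  qed
  then obtain g where g: "(Var i - Var (Suc i)) * g = f - swap_vars i f"
    by (metis dvdE poly_subst_Var_id)
  show ?thesis
    unfolding divided_difference_def swap_vars_def[symmetric]
  proof (rule theI[of _ g])
    show "g' = g" if "(Var i - Var (Suc i)) * g' = f - swap_vars i f" for g'
      using that g by (metis Var_eq_iff mult_left_cancel n_not_Suc_n right_minus_eq)
  qed (rule g)
qed

lemma divided_difference_eqI:
  assumes "(Var i - Var (Suc i)) * g = f - swap_vars i f"
  shows "divided_difference i f = g"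
  using divided_difference_spec[of i f] assms by (metis Var_eq_iff mult_left_cancel n_not_Suc_n right_minus_eq)

lemma swap_vars_divided_difference: "swap_vars i (divided_difference i f) = divided_difference i f"
proof -
  have "(Var (Suc i) - Var i) * swap_vars i (divided_difference i f) = swap_vars i f - f"
    using arg_cong[OF divided_difference_spec[of i f], of "swap_vars i"]
    by (simp add: swap_vars.hom_mult swap_vars.hom_minus swap_vars_Var)
  then have "(Var i - Var (Suc i)) * swap_vars i (divided_difference i f) = f - swap_vars i f"
    by (simp add: algebra_simps)
  then show ?thesis by (metis divided_difference_eqI)
qed

lemma divided_difference_commute:
  assumes "Suc i < j"
  shows "divided_difference i (divided_difference j f) = divided_difference j (divided_difference i f)"
proof -
  let ?a = "Var i - Var (Suc i)" and ?b = "Var j - Var (Suc j)"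
  let ?p = "divided_difference j f" and ?q = "divided_difference i f"
  have sb: "swap_vars i ?b = ?b" and sa: "swap_vars j ?a = ?a"
    using assms by (auto simp: swap_vars.hom_minus swap_vars_Var transpose_def)
  have p: "?b * ?p = f - swap_vars j f" and q: "?a * ?q = f - swap_vars i f"
    by (rule divided_difference_spec)+
  have sp: "?b * swap_vars i ?p = swap_vars i f - swap_vars i (swap_vars j f)"
    using arg_cong[OF p, of "swap_vars i"] sb by (simp add: swap_vars.hom_mult swap_vars.hom_minus)
  have sq: "?a * swap_vars j ?q = swap_vars j f - swap_vars i (swap_vars j f)"
    using arg_cong[OF q, of "swap_vars j"] sa swap_vars_commute[OF assms, of f]
    by (simp add: swap_vars.hom_mult swap_vars.hom_minus)
  have r: "?b * divided_difference j ?q = ?q - swap_vars j ?q"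
    by (rule divided_difference_spec)
  show ?thesis
  proof (rule divided_difference_eqI)
    have "?b * (?a * divided_difference j ?q) = ?a * ?q - ?a * swap_vars j ?q"
      using r by (metis (no_types, lifting) mult.left_commute right_diff_distrib)
    also have "\<dots> = ?b * (?p - swap_vars i ?p)"
      unfolding q sq right_diff_distrib[of ?b] p sp by simp
    finally show "?a * divided_difference j ?q = ?p - swap_vars i ?p"
      by (metis Var_eq_iff mult_left_cancel n_not_Suc_n right_minus_eq)
  qed
qed

text \<open>Both threefold compositions of divided differences are \<open>\<Sum>\<^sub>w sgn(w) w f\<close>, where \<open>w\<close> runs
  over the permutations of three variables, divided by the Vandermonde product of these variables. The
  two expansions differ only in the reduced word for the longest \<open>w\<close>.\<close>

lemma divided_difference_braid1:
  fixes i :: nat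
  defines "s \<equiv> swap_vars i" and "t \<equiv> swap_vars (Suc i)"
  defines "a \<equiv> Var i" and "b \<equiv> Var (Suc i)" and "c \<equiv> Var (Suc (Suc i))"
  shows "(a - b) * (a - c) * (b - c) *
      divided_difference i (divided_difference (Suc i) (divided_difference i f))
      = f - s f - t f + t (s f) + s (t f) - s (t (s f))"
proof -
  let ?p = "divided_difference i f"
  let ?g = "divided_difference (Suc i) ?p"
  have v: "s a = b" "s b = a" "s c = c" "t a = a" "t b = c" "t c = b"
    by (auto simp: a_def b_def c_def s_def t_def swap_vars_Var transpose_def)
  note h = swap_vars.hom_mult[of i, folded s_def] swap_vars.hom_minus[of i, folded s_def]
    swap_vars.hom_mult[of "Suc i", folded t_def] swap_vars.hom_minus[of "Suc i", folded t_def]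
  have 1: "(a - b) * ?p = f - s f" "(b - c) * ?g = ?p - t ?p" "(a - b) * divided_difference i ?g = ?g - s ?g"
    unfolding a_def b_def c_def s_def t_def by (rule divided_difference_spec)+
  have 2: "(a - c) * t ?p = t f - t (s f)"
    using arg_cong[OF 1(1), of t] by (simp add: h v)
  have 3: "s ?p = ?p"
    unfolding s_def by (rule swap_vars_divided_difference)
  have 4: "(b - c) * s (t ?p) = s (t f) - s (t (s f))"
    using arg_cong[OF 2, of s] by (simp add: h v)
  have 5: "(a - c) * s ?g = ?p - s (t ?p)"
    using arg_cong[OF 1(2), of s] by (simp add: h v 3)
  have "(a - b) * (a - c) * (b - c) * divided_difference i ?g
      = (a - c) * (b - c) * ((a - b) * divided_difference i ?g)"
    by (simp only: mult_ac)
  also have "\<dots> = (a - c) * ((b - c) * ?g) - (b - c) * ((a - c) * s ?g)"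
    unfolding 1(3) by (simp add: algebra_simps)
  also have "\<dots> = (a - b) * ?p - (a - c) * t ?p + (b - c) * s (t ?p)"
    unfolding 1(2) 5 by (simp add: algebra_simps)
  finally show ?thesis
    unfolding 1(1) 2 4 by simp
qed

lemma divided_difference_braid2:
  fixes i :: nat
  defines "s \<equiv> swap_vars i" and "t \<equiv> swap_vars (Suc i)"
  defines "a \<equiv> Var i" and "b \<equiv> Var (Suc i)" and "c \<equiv> Var (Suc (Suc i))"
  shows "(a - b) * (a - c) * (b - c) *
      divided_difference (Suc i) (divided_difference i (divided_difference (Suc i) f))
      = f - s f - t f + t (s f) + s (t f) - t (s (t f))"
proof -
  let ?p = "divided_difference (Suc i) f"
  let ?g = "divided_difference i ?p"
  have v: "s a = b" "s b = a" "s c = c" "t a = a" "t b = c" "t c = b"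
    by (auto simp: a_def b_def c_def s_def t_def swap_vars_Var transpose_def)
  note h = swap_vars.hom_mult[of i, folded s_def] swap_vars.hom_minus[of i, folded s_def]
    swap_vars.hom_mult[of "Suc i", folded t_def] swap_vars.hom_minus[of "Suc i", folded t_def]
  have 1: "(b - c) * ?p = f - t f" "(a - b) * ?g = ?p - s ?p"
    "(b - c) * divided_difference (Suc i) ?g = ?g - t ?g"
    unfolding a_def b_def c_def s_def t_def by (rule divided_difference_spec)+
  have 2: "(a - c) * s ?p = s f - s (t f)"
    using arg_cong[OF 1(1), of s] by (simp add: h v)
  have 3: "t ?p = ?p"
    unfolding t_def by (rule swap_vars_divided_difference)
  have 4: "(a - b) * t (s ?p) = t (s f) - t (s (t f))"
    using arg_cong[OF 2, of t] by (simp add: h v)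
  have 5: "(a - c) * t ?g = ?p - t (s ?p)"
    using arg_cong[OF 1(2), of t] by (simp add: h v 3)
  have "(a - b) * (a - c) * (b - c) * divided_difference (Suc i) ?g
      = (a - b) * (a - c) * ((b - c) * divided_difference (Suc i) ?g)"
    by (simp only: mult_ac)
  also have "\<dots> = (a - c) * ((a - b) * ?g) - (a - b) * ((a - c) * t ?g)"
    unfolding 1(3) by (simp add: algebra_simps)
  also have "\<dots> = (b - c) * ?p - (a - c) * s ?p + (a - b) * t (s ?p)"
    unfolding 1(2) 5 by (simp add: algebra_simps)
  finally show ?thesis
    unfolding 1(1) 2 4 by simp
qed

lemma divided_difference_braid:
  "divided_difference i (divided_difference (Suc i) (divided_difference i f))
   = divided_difference (Suc i) (divided_difference i (divided_difference (Suc i) f))"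
proof -
  let ?V = "(Var i - Var (Suc i)) * (Var i - Var (Suc (Suc i))) * (Var (Suc i) - Var (Suc (Suc i)))"
  have "?V * divided_difference i (divided_difference (Suc i) (divided_difference i f))
     = ?V * divided_difference (Suc i) (divided_difference i (divided_difference (Suc i) f))"
    unfolding divided_difference_braid1 divided_difference_braid2 swap_vars_braid by simp
  moreover have "?V \<noteq> 0" by simp
  ultimately show ?thesis by (metis mult_left_cancel)
qed

section \<open>Existence and uniqueness of Schubert polynomials\<close>

text \<open>The set whose cardinality is \<open>perm_length\<close>.\<close>

definition inversions :: "(nat \<Rightarrow> nat) \<Rightarrow> (nat \<times> nat) set" where
  "inversions w = {(i, j). i < j \<and> w j < w i}"

lemma perm_length_altdef: "perm_length w = card (inversions w)"
  by (simp add: perm_length_def inversions_def)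

lemma inversions_subset:
  assumes "w permutes {1..n}"
  shows "inversions w \<subseteq> {1..n} \<times> {1..n}"
proof
  fix p assume "p \<in> inversions w"
  then obtain i j where p: "p = (i, j)" and ij: "i < j" "w j < w i"
    by (auto simp: inversions_def)
  have out: "w k = k" if "k \<notin> {1..n}" for k
    using assms that by (rule permutes_not_in)
  have ins: "w k \<in> {1..n}" if "k \<in> {1..n}" for k
    using permutes_in_image[OF assms, of k] that by simp
  have "i \<noteq> 0"
  proof
    assume "i = 0"
    with ij out[of 0] show False by simp
  qed
  moreover have "j \<le> n" using ij out[of i] out[of j] ins[of i] by (cases "i \<le> n"; cases "i = 0") auto
  ultimately show "p \<in> {1..n} \<times> {1..n}"
    using ij by (auto simp: p)
qed

lemma perm_length_le:
  assumes "w permutes {1..n}"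
  shows "perm_length w \<le> n * n"
proof -
  have "card (inversions w) \<le> card ({1..n} \<times> {1..n})"
    by (rule card_mono) (use inversions_subset[OF assms] in auto)
  then show ?thesis by (simp add: perm_length_altdef)
qed

text \<open>Right multiplication by \<open>s\<^sub>i\<close> at an ascent moves the inversions along \<open>s\<^sub>i \<times> s\<^sub>i\<close> and adds the
  pair \<open>(i, i + 1)\<close>.\<close>

lemma perm_length_swap_ascent:
  assumes w: "w permutes {1..n}" and less: "w i < w (Suc i)"
  shows "perm_length (w \<circ> transpose i (Suc i)) = perm_length w + 1"
proof -
  let ?t = "transpose i (Suc i)"
  have fin: "finite (inversions w)"
    by (rule finite_subset[OF inversions_subset[OF w]]) auto
  have mono: "?t a < ?t b" if "a < b" "(a, b) \<noteq> (i, Suc i)" for a b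
    using that by (auto simp: transpose_def)
  have "inversions (w \<circ> ?t) = insert (i, Suc i) (map_prod ?t ?t ` inversions w)"
  proof (intro equalityI subsetI)
    fix p assume "p \<in> inversions (w \<circ> ?t)"
    then obtain a b where p: "p = (a, b)" "a < b" "w (?t b) < w (?t a)"
      by (auto simp: inversions_def)
    show "p \<in> insert (i, Suc i) (map_prod ?t ?t ` inversions w)"
    proof (cases "p = (i, Suc i)")
      case False
      then have "(?t a, ?t b) \<in> inversions w"
        using p mono[of a b] by (auto simp: inversions_def)
      then have "map_prod ?t ?t (?t a, ?t b) \<in> map_prod ?t ?t ` inversions w"
        by (rule imageI)
      then show ?thesis using p by simp
    qed simp
  next
    fix p assume p: "p \<in> insert (i, Suc i) (map_prod ?t ?t ` inversions w)"
    show "p \<in> inversions (w \<circ> ?t)"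
    proof (cases "p = (i, Suc i)")
      case True
      then show ?thesis using less by (simp add: inversions_def)
    next
      case False
      with p obtain a b where ab: "p = (?t a, ?t b)" "a < b" "w b < w a"
        by (auto simp: inversions_def)
      have "(a, b) \<noteq> (i, Suc i)" using ab less by auto
      then show ?thesis using ab mono[of a b] by (simp add: inversions_def)
    qed
  qed
  moreover have "(i, Suc i) \<notin> map_prod ?t ?t ` inversions w"
  proof
    assume "(i, Suc i) \<in> map_prod ?t ?t ` inversions w"
    then obtain p where "(i, Suc i) = map_prod ?t ?t p" "p \<in> inversions w"
      by (rule imageE)
    then show False
      by (cases p) (auto simp: transpose_def inversions_def split: if_splits)
  qed
  moreover have "card (map_prod ?t ?t ` inversions w) = card (inversions w)"
    by (rule card_image) (intro inj_on_subset[OF map_prod_inj_on[of ?t UNIV ?t UNIV]], auto)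
  ultimately show ?thesis
    using fin by (simp add: perm_length_altdef)
qed

lemma swap_permutes:
  assumes "w permutes {1..n}" "1 \<le> i" "i < n"
  shows "w \<circ> transpose i (Suc i) permutes {1..n}"
  by (intro permutes_compose permutes_swap_id assms) (use assms in auto)

lemma swap_swap [simp]: "w \<circ> transpose i j \<circ> transpose i j = w"
  by (simp add: comp_assoc)

lemma longest_perm_apply: "longest_perm n i = (if 1 \<le> i \<and> i \<le> n then Suc n - i else i)"
  by (auto simp: longest_perm_def one_line_def rev_nth simp del: upt_Suc)

lemma longest_perm_permutes: "longest_perm n permutes {1..n}"
proof (rule bij_imp_permutes)
  show "bij_betw (longest_perm n) {1..n} {1..n}"
    by (rule bij_betw_byWitness[where f' = "longest_perm n"]) (auto simp: longest_perm_apply)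
qed (auto simp: longest_perm_apply)

lemma is_schubert_permutes: "is_schubert n w f \<Longrightarrow> w permutes {1..n}"
proof (induction rule: is_schubert.induct)
  case longest
  show ?case by (rule longest_perm_permutes)
next
  case descend
  then show ?case by (intro swap_permutes)
qed

lemma is_schubert_ascent:
  assumes "is_schubert n (w \<circ> transpose i (Suc i)) f" "1 \<le> i" "i < n" "w i < w (Suc i)"
  shows "is_schubert n w (divided_difference i f)"
proof -
  have "w permutes {1..n}"
    using swap_permutes[OF is_schubert_permutes[OF assms(1)] assms(2,3)] by simp
  then have "perm_length (w \<circ> transpose i (Suc i)) = perm_length w + 1"
    using assms(4) by (rule perm_length_swap_ascent)
  then show ?thesis
    using is_schubert.descend[OF assms(1-3)] by simp
qed

lemma is_schubert_cases_ascent: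
  assumes "is_schubert n w f"
  obtains (longest) "w = longest_perm n" "f = (\<Prod>i = 1..n. Var i ^ (n - i))"
  | (ascent) i g where "1 \<le> i" "i < n" "w i < w (Suc i)"
      "is_schubert n (w \<circ> transpose i (Suc i)) g" "f = divided_difference i g"
  using assms
proof (cases rule: is_schubert.cases)
  case longest
  then show ?thesis by (rule that(1))
next
  case (descend u g i)
  have u: "u permutes {1..n}" by (rule is_schubert_permutes[OF descend(3)])
  have "u i \<noteq> u (Suc i)"
    using permutes_inj[OF u] by (metis injD n_not_Suc_n)
  moreover have "\<not> u i < u (Suc i)"
    using perm_length_swap_ascent[OF u, of i] descend(6) by auto
  ultimately have "w i < w (Suc i)"
    by (simp add: descend(1))
  then show ?thesis
    using that(2)[of i g] descend by simp
qed

lemma no_ascent_longest: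
  assumes w: "w permutes {1..n}" and no: "\<And>i. 1 \<le> i \<Longrightarrow> i < n \<Longrightarrow> \<not> w i < w (Suc i)"
  shows "w = longest_perm n"
proof -
  have ins: "w k \<in> {1..n}" if "k \<in> {1..n}" for k
    using permutes_in_image[OF w, of k] that by simp
  have dec: "w (Suc i) < w i" if "1 \<le> i" "i < n" for i
  proof -
    have "w i \<noteq> w (Suc i)" using permutes_inj[OF w] by (metis injD n_not_Suc_n)
    with no[OF that] show ?thesis by simp
  qed
  have up: "w (Suc k) + k \<le> n" if "k < n" for k
    using that
  proof (induction k)
    case 0 then show ?case using ins[of 1] by simp
  next
    case (Suc k) then show ?case using dec[of "Suc k"] by simp
  qed
  have lo: "Suc k \<le> w (n - k)" if "k < n" for k
    using that
  proof (induction k)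
    case 0 then show ?case using ins[of n] by simp
  next
    case (Suc k)
    then have "Suc (n - Suc k) = n - k" by simp
    moreover have "1 \<le> n - Suc k" using Suc.prems by simp
    ultimately show ?case using Suc dec[of "n - Suc k"] by simp
  qed
  show ?thesis
  proof
    fix i
    show "w i = longest_perm n i"
    proof (cases "1 \<le> i \<and> i \<le> n")
      case True
      then show ?thesis
        using up[of "i - 1"] lo[of "n - i"] by (cases i) (auto simp: longest_perm_apply)
    next
      case False
      then show ?thesis
        using permutes_not_in[OF w, of i] by (auto simp: longest_perm_apply)
    qed
  qed
qed

text \<open>Induction on the distance from the longest permutation: a statement about \<open>w\<close> may use
  the statement about \<open>w s\<^sub>i\<close> for every ascent \<open>i\<close> of \<open>w\<close>.\<close>

lemma colength_induct [consumes 1, case_names step]: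
  assumes "w permutes {1..n}"
    and "\<And>w. w permutes {1..n} \<Longrightarrow>
      (\<And>i. 1 \<le> i \<Longrightarrow> i < n \<Longrightarrow> w i < w (Suc i) \<Longrightarrow> P (w \<circ> transpose i (Suc i))) \<Longrightarrow> P w"
  shows "P w"
  using assms(1)
proof (induction "n * n - perm_length w" arbitrary: w rule: less_induct)
  case less
  show ?case
  proof (rule assms(2)[OF less.prems])
    fix i assume i: "1 \<le> i" "i < n" "w i < w (Suc i)"
    have p: "w \<circ> transpose i (Suc i) permutes {1..n}"
      using less.prems i by (intro swap_permutes)
    show "P (w \<circ> transpose i (Suc i))"
      using less.hyps[OF _ p] perm_length_swap_ascent[OF less.prems i(3)] perm_length_le[OF p] by simp
  qed
qed

lemma is_schubert_exists:
  assumes "w permutes {1..n}"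
  shows "\<exists>f. is_schubert n w f"
  using assms
proof (induction w rule: colength_induct)
  case (step w)
  show ?case
  proof (cases "\<exists>i. 1 \<le> i \<and> i < n \<and> w i < w (Suc i)")
    case True
    with step.IH show ?thesis by (blast intro: is_schubert_ascent)
  next
    case False
    then have "w = longest_perm n" using no_ascent_longest[OF step.hyps] by blast
    then show ?thesis using is_schubert.longest by blast
  qed
qed

text \<open>A diamond argument. If the last steps into \<open>w\<close> use \<open>s\<^sub>i\<close> and \<open>s\<^sub>j\<close> with \<open>i \<noteq> j\<close>, then \<open>w\<close> has
  ascents at \<open>i\<close> and \<open>j\<close>, and some polynomial belongs to the longest element of the coset of \<open>w\<close>
  under the subgroup generated by \<open>s\<^sub>i\<close> and \<open>s\<^sub>j\<close>. By induction both chains may be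
  rerouted through this element, where the commutation or the braid relation applies.\<close>

lemma is_schubert_unique:
  assumes "is_schubert n w f" "is_schubert n w g"
  shows "f = g"
proof -
  have "w permutes {1..n}" using assms(1) by (rule is_schubert_permutes)
  then have "\<forall>f g. is_schubert n w f \<longrightarrow> is_schubert n w g \<longrightarrow> f = g"
  proof (induction w rule: colength_induct)
    case (step w)
    have longest: "\<not> longest_perm n i < longest_perm n (Suc i)" if "1 \<le> i" "i < n" for i
      using that by (simp add: longest_perm_apply)
    let ?s = "\<lambda>i. transpose i (Suc i)"
    note IH = step.IH[rule_format]
    have join: "f = g"
      if ij: "i < j" and i: "1 \<le> i" "i < n" "w i < w (Suc i)" and j: "1 \<le> j" "j < n" "w j < w (Suc j)"
        and f1: "is_schubert n (w \<circ> ?s i) f1" "f = divided_difference i f1"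
        and g1: "is_schubert n (w \<circ> ?s j) g1" "g = divided_difference j g1" for i j f1 g1 f g
    proof (cases "j = Suc i")
      case False
      have comm: "w \<circ> ?s i \<circ> ?s j = w \<circ> ?s j \<circ> ?s i"
        using ij False by (auto simp: fun_eq_iff transpose_def)
      have "w \<circ> ?s i \<circ> ?s j permutes {1..n}"
        by (intro swap_permutes step.hyps i j)
      then obtain h where h: "is_schubert n (w \<circ> ?s i \<circ> ?s j) h"
        using is_schubert_exists by blast
      have "is_schubert n (w \<circ> ?s i) (divided_difference j h)"
        by (rule is_schubert_ascent[OF h]) (use ij False j in \<open>auto simp: transpose_def\<close>)
      then have "f1 = divided_difference j h"
        using IH[OF i f1(1)] by simp
      moreover have "is_schubert n (w \<circ> ?s j) (divided_difference i h)"
        by (rule is_schubert_ascent) (use h comm ij False i in \<open>auto simp: transpose_def\<close>)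
      then have "g1 = divided_difference i h"
        using IH[OF j g1(1)] by simp
      ultimately show ?thesis
        using f1 g1 divided_difference_commute[of i j h] ij False by simp
    next
      case True
      let ?j = "Suc i"
      let ?u = "w \<circ> ?s i \<circ> ?s ?j \<circ> ?s i"
      have braid: "?u = w \<circ> ?s ?j \<circ> ?s i \<circ> ?s ?j"
        by (auto simp: fun_eq_iff transpose_def)
      have j': "w ?j < w (Suc ?j)" "?j < n" using True j by auto
      have "?u permutes {1..n}"
        by (intro swap_permutes step.hyps) (use i j True in auto)
      then obtain h where h: "is_schubert n ?u h"
        using is_schubert_exists by blast
      have "is_schubert n (w \<circ> ?s i) (divided_difference ?j (divided_difference i h))"
        by (intro is_schubert_ascent h) (use i j' in \<open>auto simp: transpose_def\<close>)
      then have "f1 = divided_difference ?j (divided_difference i h)"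
        using IH[OF i f1(1)] by simp
      moreover have "is_schubert n (w \<circ> ?s ?j) (divided_difference i (divided_difference ?j h))"
        by (intro is_schubert_ascent h[unfolded braid]) (use i j' in \<open>auto simp: transpose_def\<close>)
      then have "g1 = divided_difference i (divided_difference ?j h)"
        using IH[OF j] g1(1) True by simp
      ultimately show ?thesis
        using f1 g1 True divided_difference_braid[of i h] by simp
    qed
    show ?case
    proof (intro allI impI)
      fix f g assume f: "is_schubert n w f" and g: "is_schubert n w g"
      from f show "f = g"
      proof (cases rule: is_schubert_cases_ascent)
        case f: longest
        from g show ?thesis
          by (cases rule: is_schubert_cases_ascent) (use f longest in auto)
      next
        case f: (ascent i f1)
        from g show ?thesis
        proof (cases rule: is_schubert_cases_ascent)
          case longest': longest
          then show ?thesis using f longest[of i] by simp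
        next
          case g: (ascent j g1)
          consider "i < j" | "i = j" | "j < i" by linarith
          then show ?thesis
          proof cases
            case 1
            then show ?thesis using join f g by blast
          next
            case 2
            then show ?thesis using IH[OF f(1-3)] f g by metis
          next
            case 3
            then show ?thesis using join f g by metis
          qed
        qed
      qed
    qed
  qed
  with assms show ?thesis by blast
qed

lemma schubert_eqI:
  assumes "is_schubert n w f"
  shows "schubert n w = f"
  unfolding schubert_def using assms is_schubert_unique by blast

section \<open>Flagged determinants of complete homogeneous polynomials\<close>

text \<open>The geometric series \<open>1 / (1 - x t)\<close>, written out because \<open>'a\<close> is only a ring.\<close>

definition geo :: "'a::comm_ring_1 \<Rightarrow> 'a fps" where
  "geo x = Abs_fps (\<lambda>m. x ^ m)"

lemma geo_nth [simp]: "fps_nth (geo x) m = x ^ m"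
  by (simp add: geo_def)

lemma geo_inverse: "(1 - fps_const x * fps_X) * geo x = 1"
proof (rule fps_ext)
  fix m
  have "fps_nth ((1 - fps_const x * fps_X) * geo x) m
      = fps_nth (geo x) m - x * fps_nth (fps_X * geo x) m"
    by (simp only: left_diff_distrib mult.assoc fps_sub_nth fps_mult_left_const_nth mult_1_left)
  then show "fps_nth ((1 - fps_const x * fps_X) * geo x) m = fps_nth 1 m"
    by (cases m) auto
qed

lemma geo_diff: "geo x - geo y = fps_const (x - y) * fps_X * geo x * geo y"
proof -
  let ?p = "1 - fps_const x * fps_X" and ?q = "1 - fps_const y * fps_X"
  have "geo x - geo y = (?q * geo y) * geo x - (?p * geo x) * geo y"
    by (simp add: geo_inverse)
  also have "\<dots> = (?q - ?p) * (geo x * geo y)"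
    by (simp add: algebra_simps)
  also have "?q - ?p = fps_const (x - y) * fps_X"
    by (simp add: algebra_simps flip: fps_const_sub)
  finally show ?thesis by (simp only: mult_ac)
qed

text \<open>The generating function \<open>\<Sum>\<^sub>m h\<^sub>m(x\<^sub>1, \<dots>, x\<^sub>r) t\<^sup>m\<close> of the complete homogeneous polynomials.\<close>

definition hgen :: "(nat \<Rightarrow> 'a::comm_ring_1) \<Rightarrow> nat \<Rightarrow> 'a fps" where
  "hgen x r = (\<Prod>i = 1..r. geo (x i))"

lemma hgen_0 [simp]: "hgen x 0 = 1"
  by (simp add: hgen_def)

lemma hgen_Suc: "hgen x (Suc r) = hgen x r * geo (x (Suc r))"
  by (simp add: hgen_def mult.commute)

text \<open>Row \<open>s\<close> and column \<open>u\<close> (both counted from \<open>0\<close>) carry \<open>h\<^sub>m(x\<^sub>1, \<dots>, x\<^sub>r)\<close> with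
  \<open>m = a\<^sub>s + s - u\<close> and \<open>r = n - a\<^sub>s\<close>; the factor \<open>fps_X ^ u\<close> makes the entry vanish if \<open>m\<close> would be
  negative. This is the Jacobi-Trudi matrix of a flagged Schur function with the order of the rows
  and of the columns reversed: \<open>a\<^sub>s\<close> is the part in row \<open>n - s\<close>, and \<open>n - a\<^sub>s\<close> its flag.\<close>

definition flagged_mat :: "(nat \<Rightarrow> 'a::comm_ring_1) \<Rightarrow> nat \<Rightarrow> (nat \<Rightarrow> nat) \<Rightarrow> 'a mat" where
  "flagged_mat x n a = mat n n (\<lambda>(s, u). fps_nth (fps_X ^ u * hgen x (n - a s)) (a s + s))"

definition flagged_det :: "(nat \<Rightarrow> 'a::comm_ring_1) \<Rightarrow> nat \<Rightarrow> (nat \<Rightarrow> nat) \<Rightarrow> 'a" where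
  "flagged_det x n a = det (flagged_mat x n a)"

lemma fps_map_hom_prod:
  assumes "comm_ring_hom h"
  shows "Abs_fps (\<lambda>m. h (fps_nth (\<Prod>i\<in>A. f i) m)) = (\<Prod>i\<in>A. Abs_fps (\<lambda>m. h (fps_nth (f i) m)))"
proof -
  interpret comm_ring_hom h by fact
  show ?thesis
  proof (induction A rule: infinite_finite_induct)
    case (insert i A)
    have "Abs_fps (\<lambda>m. h (fps_nth (f i * (\<Prod>i\<in>A. f i)) m))
       = Abs_fps (\<lambda>m. h (fps_nth (f i) m)) * Abs_fps (\<lambda>m. h (fps_nth (\<Prod>i\<in>A. f i) m))"
      by (rule fps_ext) (simp add: fps_mult_nth hom_sum hom_mult)
    with insert show ?case by simp
  qed (auto intro!: fps_ext)
qed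

lemma hom_hgen_nth:
  assumes "comm_ring_hom h"
  shows "h (fps_nth (hgen x r) m) = fps_nth (hgen (\<lambda>i. h (x i)) r) m"
proof -
  interpret comm_ring_hom h by fact
  have "Abs_fps (\<lambda>m. h (fps_nth (geo y) m)) = geo (h y)" for y
    by (rule fps_ext) (simp add: hom_power)
  then have "Abs_fps (\<lambda>m. h (fps_nth (hgen x r) m)) = hgen (\<lambda>i. h (x i)) r"
    by (simp add: hgen_def fps_map_hom_prod[OF assms])
  then show ?thesis
    by (metis fps_nth_Abs_fps)
qed

lemma hom_flagged_det:
  assumes "comm_ring_hom h"
  shows "h (flagged_det x n a) = flagged_det (\<lambda>i. h (x i)) n a"
proof -
  interpret comm_ring_hom h by fact
  have "map_mat h (flagged_mat x n a) = flagged_mat (\<lambda>i. h (x i)) n a"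
    by (rule eq_matI) (auto simp: flagged_mat_def fps_X_power_mult_nth hom_hgen_nth[OF assms])
  then show ?thesis
    unfolding flagged_det_def hom_det[symmetric] by simp
qed

lemma det_row_linear:
  fixes d :: "'a::comm_ring_1"
  assumes A: "A \<in> carrier_mat n n" "B \<in> carrier_mat n n" "C \<in> carrier_mat n n" and r: "r < n"
    and row: "\<And>j. j < n \<Longrightarrow> d * C $$ (r, j) = A $$ (r, j) - B $$ (r, j)"
    and AC: "\<And>i j. i < n \<Longrightarrow> j < n \<Longrightarrow> i \<noteq> r \<Longrightarrow> C $$ (i, j) = A $$ (i, j)"
    and AB: "\<And>i j. i < n \<Longrightarrow> j < n \<Longrightarrow> i \<noteq> r \<Longrightarrow> B $$ (i, j) = A $$ (i, j)"
  shows "d * det C = det A - det B"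
proof -
  have "mat_delete C r j = mat_delete A r j" "mat_delete B r j = mat_delete A r j" if "j < n" for j
    by (rule eq_matI; use A r that AC AB in \<open>auto simp: mat_delete_def\<close>)+
  then have cof: "cofactor C r j = cofactor A r j" "cofactor B r j = cofactor A r j" if "j < n" for j
    using that by (simp_all add: cofactor_def)
  have "d * det C = (\<Sum>j<n. (d * C $$ (r, j)) * cofactor A r j)"
    by (simp add: laplace_expansion_row[OF A(3) r] sum_distrib_left cof mult.assoc)
  also have "\<dots> = (\<Sum>j<n. A $$ (r, j) * cofactor A r j - B $$ (r, j) * cofactor A r j)"
    by (simp add: row left_diff_distrib)
  also have "\<dots> = det A - det B"
    by (simp add: laplace_expansion_row[OF A(1) r] laplace_expansion_row[OF A(2) r] cof sum_subtractf)
  finally show ?thesis .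
qed

lemma hgen_swap_eq:
  assumes "r \<noteq> i" "1 \<le> i"
  shows "hgen (x \<circ> transpose i (Suc i)) r = hgen x r"
proof (cases "r < i")
  case True
  then show ?thesis
    unfolding hgen_def by (intro prod.cong) (auto simp: transpose_def)
next
  case False
  have "transpose i (Suc i) permutes {1..r}"
    by (rule permutes_swap_id) (use assms False in auto)
  from prod.permute[OF this, of "\<lambda>i. geo (x i)"] show ?thesis
    by (simp add: hgen_def comp_def)
qed

lemma hgen_swap_diff:
  assumes "1 \<le> i"
  shows "hgen x i - hgen (x \<circ> transpose i (Suc i)) i
    = fps_const (x i - x (Suc i)) * (fps_X * hgen x (Suc i))"
proof -
  obtain r where r: "i = Suc r" using assms by (cases i) auto
  have "hgen x i - hgen (x \<circ> transpose i (Suc i)) i = hgen x r * (geo (x i) - geo (x (Suc i)))"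
    using hgen_swap_eq[of r i x] assms by (simp add: r hgen_Suc algebra_simps)
  then show ?thesis
    by (simp only: geo_diff r hgen_Suc mult_ac)
qed

text \<open>If exactly one row has flag \<open>i\<close>, then all other rows are symmetric in \<open>x\<^sub>i\<close> and \<open>x\<^sub>i\<^sub>+\<^sub>1\<close>, and
  \<open>\<partial>\<^sub>i\<close> acts on that row alone, by \<open>\<partial>\<^sub>i h\<^sub>m(x\<^sub>1, \<dots>, x\<^sub>i) = h\<^sub>m\<^sub>-\<^sub>1(x\<^sub>1, \<dots>, x\<^sub>i\<^sub>+\<^sub>1)\<close>. The determinant keeps
  its shape: the part decreases by one and the flag grows by one.\<close>

lemma divided_difference_flagged_det:
  assumes s: "s < n" and as: "1 \<le> a s" "a s < n"
    and other: "\<And>s'. s' < n \<Longrightarrow> s' \<noteq> s \<Longrightarrow> a s' \<noteq> a s \<and> a s' \<le> n"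
  shows "divided_difference (n - a s) (flagged_det Var n a) = flagged_det Var n (a(s := a s - 1))"
proof (rule divided_difference_eqI)
  let ?i = "n - a s"
  let ?x' = "Var \<circ> transpose ?i (Suc ?i)"
  have i: "1 \<le> ?i" using as by simp
  have swap: "swap_vars ?i (flagged_det Var n a) = flagged_det ?x' n a"
    unfolding hom_flagged_det[OF swap_vars.comm_ring_hom_axioms] swap_vars_Var
    by (simp add: comp_def)
  have [simp]: "n - (a s - Suc 0) = Suc ?i" using as by simp
  obtain b where b: "a s = Suc b" using as by (cases "a s") auto
  show "(Var ?i - Var (Suc ?i)) * flagged_det Var n (a(s := a s - 1))
      = flagged_det Var n a - swap_vars ?i (flagged_det Var n a)"
    unfolding swap unfolding flagged_det_def
  proof (rule det_row_linear[OF _ _ _ s])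
    fix j assume j: "j < n"
    have "fps_nth (fps_X ^ j * hgen Var ?i) (a s + s) - fps_nth (fps_X ^ j * hgen ?x' ?i) (a s + s)
        = fps_nth (fps_X ^ j * (hgen Var ?i - hgen ?x' ?i)) (a s + s)"
      by (simp add: algebra_simps)
    also have "fps_X ^ j * (hgen Var ?i - hgen ?x' ?i)
        = fps_const (Var ?i - Var (Suc ?i)) * (fps_X * (fps_X ^ j * hgen Var (Suc ?i)))"
      unfolding hgen_swap_diff[OF i] by (simp only: mult_ac)
    also have "fps_nth \<dots> (a s + s) = (Var ?i - Var (Suc ?i)) * fps_nth (fps_X ^ j * hgen Var (Suc ?i)) (a s - 1 + s)"
      unfolding fps_mult_left_const_nth by (simp add: b)
    finally show "(Var ?i - Var (Suc ?i)) * flagged_mat Var n (a(s := a s - 1)) $$ (s, j)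
        = flagged_mat Var n a $$ (s, j) - flagged_mat ?x' n a $$ (s, j)"
      using s j by (simp add: flagged_mat_def comp_def)
  next
    fix s' j assume *: "s' < n" "j < n" "s' \<noteq> s"
    then have "n - a s' \<noteq> ?i" using other[of s'] as by auto
    then show "flagged_mat ?x' n a $$ (s', j) = flagged_mat Var n a $$ (s', j)"
      using * i by (simp add: flagged_mat_def hgen_swap_eq)
  qed (auto simp: flagged_mat_def)
qed

text \<open>The product of the factors \<open>1 - x\<^sub>i t\<close> over \<open>i \<in> A\<close>, for finite \<open>A\<close> a polynomial of degree at most \<open>|A|\<close>.\<close>

definition lin_prod :: "(nat \<Rightarrow> 'a::comm_ring_1) \<Rightarrow> nat set \<Rightarrow> 'a fps" where
  "lin_prod x A = (\<Prod>i\<in>A. 1 - fps_const (x i) * fps_X)"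

lemma lin_prod_nth_0 [simp]: "fps_nth (lin_prod x A) 0 = 1"
  unfolding lin_prod_def by (induction A rule: infinite_finite_induct) auto

lemma lin_prod_nth_eq_0:
  assumes "finite A" "card A < k"
  shows "fps_nth (lin_prod x A) k = 0"
  using assms
proof (induction A arbitrary: k rule: finite_induct)
  case empty
  then show ?case by (simp add: lin_prod_def)
next
  case (insert i A)
  have "lin_prod x (insert i A) = lin_prod x A - fps_const (x i) * (fps_X * lin_prod x A)"
    using insert by (simp add: lin_prod_def algebra_simps)
  then show ?case
    using insert by (simp add: fps_mult_left_const_nth del: fps_const_mult)
qed

lemma lin_prod_hgen: "lin_prod x {1..r} * hgen x r = 1"
  unfolding lin_prod_def hgen_def prod.distrib[symmetric] geo_inverse by simp

lemma lin_prod_hgen_ge: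
  assumes "r \<le> l"
  shows "lin_prod x {1..l} * hgen x r = lin_prod x {Suc r..l}"
proof -
  have "{1..l} = {1..r} \<union> {Suc r..l}"
    using assms by auto
  then have "lin_prod x {1..l} = lin_prod x {1..r} * lin_prod x {Suc r..l}"
    unfolding lin_prod_def by (simp add: prod.union_disjoint)
  then have "lin_prod x {1..l} * hgen x r = lin_prod x {1..r} * hgen x r * lin_prod x {Suc r..l}"
    by (simp only: mult_ac)
  then show ?thesis by (simp only: lin_prod_hgen mult_1_left)
qed

lemma lin_prod_hgen_le:
  assumes "l \<le> r"
  shows "lin_prod x {1..l} * hgen x r = (\<Prod>i = Suc l..r. geo (x i))"
proof -
  have "{1..r} = {1..l} \<union> {Suc l..r}"
    using assms by auto
  then have "hgen x r = hgen x l * (\<Prod>i = Suc l..r. geo (x i))"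
    unfolding hgen_def by (simp add: prod.union_disjoint)
  then have "lin_prod x {1..l} * hgen x r = lin_prod x {1..l} * hgen x l * (\<Prod>i = Suc l..r. geo (x i))"
    by (simp only: mult_ac)
  then show ?thesis by (simp only: lin_prod_hgen mult_1_left)
qed

text \<open>The coefficient of \<open>Q G\<close> is the combination of those of \<open>t\<^sup>v G\<close> given by the coefficients
  of the polynomial \<open>Q\<close>, that is, a column operation.\<close>

lemma sum_columns:
  fixes Q G :: "'a::comm_ring_1 fps"
  assumes "\<And>v. n \<le> v \<Longrightarrow> fps_nth Q v = 0"
  shows "fps_nth (Q * G) c = (\<Sum>v<n. fps_nth (fps_X ^ v * G) c * fps_nth Q v)"
proof -
  have "fps_nth (Q * G) c = (\<Sum>v\<in>{0..c} \<union> {..<n}. fps_nth (fps_X ^ v * G) c * fps_nth Q v)"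
    unfolding fps_mult_nth[of Q G] fps_X_power_mult_nth
    by (rule sum.mono_neutral_cong_left) (auto simp: mult.commute)
  also have "\<dots> = (\<Sum>v<n. fps_nth (fps_X ^ v * G) c * fps_nth Q v)"
    by (rule sum.mono_neutral_right) (auto simp: assms)
  finally show ?thesis .
qed

text \<open>The polynomials \<open>t\<^sup>u (1 - x\<^sub>1 t) \<dots> (1 - x\<^sub>l t)\<close> with \<open>l = n - 1 - u\<close> have degree less than \<open>n\<close>
  and lowest term \<open>t\<^sup>u\<close>, so they arise from the powers \<open>t\<^sup>u\<close>, \<open>u < n\<close>, by a unitriangular
  change of basis. Up to reversal they are the Newton basis at the nodes \<open>x\<^sub>1, x\<^sub>2, \<dots>\<close>.\<close>

lemma det_newton_columns:
  fixes x :: "nat \<Rightarrow> 'a::comm_ring_1"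
  shows "det (mat n n (\<lambda>(s, u). fps_nth (fps_X ^ u * G s) (c s)))
    = det (mat n n (\<lambda>(s, u). fps_nth (fps_X ^ u * lin_prod x {1..n - Suc u} * G s) (c s)))"
    (is "det ?A = det ?B")
proof -
  let ?Q = "\<lambda>u. fps_X ^ u * lin_prod x {1..n - Suc u}"
  let ?W = "mat n n (\<lambda>(v, u). fps_nth (?Q u) v)"
  have "?B = ?A * ?W"
  proof (rule eq_matI)
    fix s u assume su: "s < dim_row (?A * ?W)" "u < dim_col (?A * ?W)"
    have "fps_nth (?Q u * G s) (c s) = (\<Sum>v<n. fps_nth (fps_X ^ v * G s) (c s) * fps_nth (?Q u) v)"
      by (rule sum_columns) (use su in \<open>auto simp: fps_X_power_mult_nth lin_prod_nth_eq_0\<close>)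
    then show "?B $$ (s, u) = (?A * ?W) $$ (s, u)"
      using su by (simp add: scalar_prod_def atLeast0LessThan)
  qed auto
  moreover have "det ?W = prod_list (diag_mat ?W)"
    by (rule det_lower_triangular[of n]) (auto simp: fps_X_power_mult_nth)
  then have "det ?W = 1"
    by (simp add: prod_list_diag_prod fps_X_power_mult_nth)
  ultimately show ?thesis
    using det_mult[of ?A n ?W] by simp
qed

text \<open>The starting point \<open>x\<^sub>1\<^sup>n\<^sup>-\<^sup>1 x\<^sub>2\<^sup>n\<^sup>-\<^sup>2 \<dots>\<close> as a flagged determinant, which becomes triangular in the
  Newton basis.\<close>

lemma flagged_det_longest: "flagged_det x n (\<lambda>s. s) = (\<Prod>i = 1..n. x i ^ (n - i))"
proof -
  let ?B = "mat n n (\<lambda>(s, u). fps_nth (fps_X ^ u * lin_prod x {1..n - Suc u} * hgen x (n - s)) (s + s))"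
  have "flagged_det x n (\<lambda>s. s) = det ?B"
    unfolding flagged_det_def flagged_mat_def by (rule det_newton_columns)
  also have "\<dots> = prod_list (diag_mat ?B)"
  proof (rule det_upper_triangular[of _ n])
    show "upper_triangular ?B"
    proof
      fix s u assume us: "u < s" "s < dim_row ?B"
      have "lin_prod x {1..n - Suc u} * hgen x (n - s) = lin_prod x {Suc (n - s)..n - Suc u}"
        by (rule lin_prod_hgen_ge) (use us in simp)
      then show "?B $$ (s, u) = 0"
        using us by (simp add: mult.assoc fps_X_power_mult_nth lin_prod_nth_eq_0)
    qed
  qed simp
  also have "\<dots> = (\<Prod>s<n. x (n - s) ^ s)"
  proof -
    have "?B $$ (s, s) = x (n - s) ^ s" if "s < n" for s
    proof -
      have "lin_prod x {1..n - Suc s} * hgen x (n - s) = geo (x (n - s))"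
        by (subst lin_prod_hgen_le) (use that in \<open>auto simp: Suc_diff_Suc\<close>)
      then show ?thesis
        using that by (simp add: mult.assoc fps_X_power_mult_nth)
    qed
    then show ?thesis by (simp add: prod_list_diag_prod atLeast0LessThan)
  qed
  also have "\<dots> = (\<Prod>i = 1..n. x i ^ (n - i))"
    by (rule prod.reindex_bij_witness[of _ "\<lambda>i. n - i" "\<lambda>s. n - s"]) auto
  finally show ?thesis .
qed

section \<open>The Schubert polynomials of the unimodal permutations\<close>

lemma is_schubert_descent:
  assumes f: "is_schubert n w f" and i: "1 \<le> i" "i < n" "w (Suc i) < w i"
  shows "is_schubert n (w \<circ> transpose i (Suc i)) (divided_difference i f)"
proof (rule is_schubert.descend[OF f i(1,2)])
  have "w \<circ> transpose i (Suc i) permutes {1..n}"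
    by (intro swap_permutes is_schubert_permutes[OF f] i)
  from perm_length_swap_ascent[OF this, of i]
  show "perm_length (w \<circ> transpose i (Suc i)) + 1 = perm_length w"
    using i(3) by simp
qed

lemma one_line_swap:
  "one_line (xs @ a # b # ys) \<circ> transpose (Suc (length xs)) (Suc (Suc (length xs)))
    = one_line (xs @ b # a # ys)"
  by (auto simp: fun_eq_iff one_line_def transpose_def nth_append nth_Cons split: nat.splits)

text \<open>The even numbers up to \<open>m\<close> in increasing order, followed by the odd ones in decreasing
  order. The list for \<open>m = 2 k\<close> is the one-line notation of \<open>w_minus k\<close>, the list for \<open>m = 2 k + 1\<close>
  that of \<open>w_plus k\<close>.\<close>

definition unimodal_list :: "nat \<Rightarrow> nat list" where
  "unimodal_list m = map (\<lambda>j. 2 * j) [1..<Suc (m div 2)] @ rev (map (\<lambda>j. 2 * j + 1) [0..<(m + 1) div 2])"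

lemma length_unimodal_list [simp]: "length (unimodal_list m) = m"
  by (simp add: unimodal_list_def del: upt_Suc)

lemma unimodal_list_le: "v \<in> set (unimodal_list m) \<Longrightarrow> v \<le> m"
  by (auto simp: unimodal_list_def)

text \<open>The new maximum is always inserted at the boundary between the even and the odd numbers.\<close>

lemma unimodal_list_Suc:
  "unimodal_list (Suc m) = take (m div 2) (unimodal_list m) @ Suc m # drop (m div 2) (unimodal_list m)"
proof (cases "even m")
  case True
  then obtain p where m: "m = 2 * p" by (elim evenE)
  show ?thesis by (simp add: unimodal_list_def m del: upt_Suc) simp
next
  case False
  then obtain p where m: "m = 2 * p + 1" by (elim oddE)
  show ?thesis by (simp add: unimodal_list_def m del: upt_Suc) simp
qed

text \<open>The permutations of the descending chain: the entries above \<open>m + 1\<close> are still in decreasing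
  order at the front, the entries up to \<open>m\<close> already form the unimodal list, and \<open>m + 1\<close> has moved
  past \<open>k\<close> of them.\<close>

definition chain_list :: "nat \<Rightarrow> nat \<Rightarrow> nat \<Rightarrow> nat list" where
  "chain_list n m k = rev [m + 2..<Suc n] @ take k (unimodal_list m) @ (m + 1) # drop k (unimodal_list m)"

text \<open>The parts \<open>a\<^sub>s\<close> of the flagged determinant that belongs to \<open>chain_list n m k\<close>. Row \<open>s\<close>
  belongs to the entry \<open>s + 1\<close>, and its part drops by one whenever that entry moves to the right.\<close>

definition chain_shape :: "nat \<Rightarrow> nat \<Rightarrow> nat \<Rightarrow> nat" where
  "chain_shape m k s = (if s < m then s - s div 2 else if s = m then m - k else s)"

lemma is_schubert_chain_step:
  assumes "m < n" "k < m div 2"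
    and f: "is_schubert n (one_line (chain_list n m k)) (flagged_det Var n (chain_shape m k))"
  shows "is_schubert n (one_line (chain_list n m (Suc k))) (flagged_det Var n (chain_shape m (Suc k)))"
proof -
  let ?v = "unimodal_list m" and ?i = "n - (m - k)"
  define xs where "xs = rev [m + 2..<Suc n] @ take k ?v"
  have k: "k < length ?v" using assms by simp
  have 1: "chain_list n m k = xs @ (m + 1) # ?v ! k # drop (Suc k) ?v"
    by (simp add: chain_list_def xs_def Cons_nth_drop_Suc[OF k] del: upt_Suc)
  have 2: "chain_list n m (Suc k) = xs @ ?v ! k # (m + 1) # drop (Suc k) ?v"
    by (simp add: chain_list_def xs_def take_Suc_conv_app_nth[OF k] del: upt_Suc)
  have i: "?i = Suc (length xs)"
    using assms k by (simp add: xs_def del: upt_Suc)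
  have "?v ! k \<le> m" using k by (intro unimodal_list_le nth_mem)
  then have "one_line (chain_list n m k) (Suc ?i) < one_line (chain_list n m k) ?i"
    unfolding 1 i by (simp add: one_line_def nth_append)
  then have "is_schubert n (one_line (chain_list n m k) \<circ> transpose ?i (Suc ?i))
      (divided_difference ?i (flagged_det Var n (chain_shape m k)))"
    by (intro is_schubert_descent f) (use assms in auto)
  moreover have "one_line (chain_list n m k) \<circ> transpose ?i (Suc ?i) = one_line (chain_list n m (Suc k))"
    unfolding 1 2 i by (rule one_line_swap)
  moreover have "divided_difference ?i (flagged_det Var n (chain_shape m k))
      = flagged_det Var n (chain_shape m (Suc k))"
  proof -
    have "divided_difference (n - chain_shape m k m) (flagged_det Var n (chain_shape m k))
       = flagged_det Var n ((chain_shape m k)(m := chain_shape m k m - 1))"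
      by (rule divided_difference_flagged_det) (use assms in \<open>auto simp: chain_shape_def\<close>)
    moreover have "(chain_shape m k)(m := chain_shape m k m - 1) = chain_shape m (Suc k)"
      by (auto simp: chain_shape_def fun_eq_iff)
    ultimately show ?thesis by (simp add: chain_shape_def)
  qed
  ultimately show ?thesis by simp
qed

lemma is_schubert_chain:
  assumes "m < n" "k \<le> m div 2"
  shows "is_schubert n (one_line (chain_list n m k)) (flagged_det Var n (chain_shape m k))"
  using assms
proof (induction m arbitrary: k)
  case 0
  have "[1..<Suc n] = 1 # [Suc 1..<Suc n]"
    by (rule upt_conv_Cons) (use 0 in simp)
  then have "chain_list n 0 0 = rev [1..<Suc n]"
    by (simp add: chain_list_def unimodal_list_def numeral_2_eq_2 del: upt_Suc)
  moreover have "chain_shape 0 0 = (\<lambda>s. s)"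
    by (simp add: chain_shape_def fun_eq_iff)
  ultimately show ?case
    using 0 is_schubert.longest[of n] by (simp add: flagged_det_longest longest_perm_def)
next
  case (Suc m)
  from \<open>k \<le> Suc m div 2\<close> show ?case
  proof (induction k)
    case 0
    have "[m + 2..<Suc n] = (m + 2) # [Suc (m + 2)..<Suc n]"
      by (rule upt_conv_Cons) (use Suc.prems in simp)
    then have "chain_list n (Suc m) 0 = chain_list n m (m div 2)"
      by (simp add: chain_list_def unimodal_list_Suc del: upt_Suc)
    moreover have "chain_shape (Suc m) 0 = chain_shape m (m div 2)"
      by (auto simp: chain_shape_def fun_eq_iff less_Suc_eq)
    ultimately show ?case
      using Suc.IH[of "m div 2"] Suc.prems by simp
  next
    case (Suc k)
    then show ?case using \<open>Suc m < n\<close> by (intro is_schubert_chain_step) auto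
  qed
qed

lemma schubert_unimodal:
  assumes "n \<ge> 1"
  shows "schubert n (one_line (unimodal_list n)) = flagged_det Var n (\<lambda>s. s - s div 2)"
proof -
  obtain m where n: "n = Suc m" using assms by (cases n) auto
  have "is_schubert n (one_line (chain_list n m (m div 2))) (flagged_det Var n (chain_shape m (m div 2)))"
    by (rule is_schubert_chain) (simp_all add: n)
  moreover have "chain_list n m (m div 2) = unimodal_list n"
    by (simp add: chain_list_def n unimodal_list_Suc)
  moreover have "flagged_det Var n (chain_shape m (m div 2)) = flagged_det Var n (\<lambda>s. s - s div 2)"
  proof -
    have "flagged_mat Var n (chain_shape m (m div 2)) = flagged_mat Var n (\<lambda>s. s - s div 2)"
      by (rule eq_matI) (auto simp: flagged_mat_def chain_shape_def n less_Suc_eq)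
    then show ?thesis by (simp add: flagged_det_def)
  qed
  ultimately show ?thesis by (intro schubert_eqI) simp
qed

lemma poly_subst_schubert_unimodal:
  assumes "n \<ge> 1"
  shows "poly_subst x (schubert n (one_line (unimodal_list n))) = flagged_det x n (\<lambda>s. s - s div 2)"
  unfolding schubert_unimodal[OF assms] hom_flagged_det[OF comm_ring_hom_poly_subst] by simp

section \<open>The determinant at all variables equal to one\<close>

lemma geo_one_power_nth: "fps_nth (geo (1::rat) ^ Suc k) m = of_nat ((m + k) choose k)"
proof (induction k arbitrary: m)
  case 0
  show ?case by simp
next
  case (Suc k)
  have "fps_nth (geo (1::rat) ^ Suc (Suc k)) m = (\<Sum>i\<le>m. fps_nth (geo 1 ^ Suc k) i)"
    by (subst power_Suc2) (simp add: fps_mult_nth atLeast0AtMost)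
  also have "\<dots> = of_nat (\<Sum>i\<le>m. (k + i) choose k)"
    by (simp add: Suc add.commute del: power_Suc)
  also have "(\<Sum>i\<le>m. (k + i) choose k) = (m + Suc k) choose Suc k"
    using choose_rising_sum(1)[of k m] by (simp add: add_ac del: binomial_Suc_Suc)
  finally show ?case .
qed

text \<open>The polynomial \<open>t\<^sup>a (1 + t)\<^sup>s\<close> with \<open>a = \<lceil>s/2\<rceil>\<close>.\<close>

definition unimodal_row :: "nat \<Rightarrow> rat fps" where
  "unimodal_row s = fps_X ^ (s - s div 2) * fps_binomial (of_nat s)"

text \<open>With all variables equal to one, the Newton basis turns the entry in row \<open>s\<close> and column \<open>u\<close>
  into the binomial coefficient \<open>s choose (u - a)\<close>, a coefficient of \<open>t\<^sup>a (1 + t)\<^sup>s\<close>. This entry no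
  longer depends on \<open>n\<close>.\<close>

lemma flagged_det_one:
  "flagged_det (\<lambda>_. 1) n (\<lambda>s. s - s div 2) = det (mat n n (\<lambda>(s, u). fps_nth (unimodal_row s) u))"
proof -
  let ?a = "\<lambda>s::nat. s - s div 2" and ?x = "\<lambda>_::nat. 1 :: rat"
  have "flagged_det ?x n ?a
      = det (mat n n (\<lambda>(s, u). fps_nth (fps_X ^ u * lin_prod ?x {1..n - Suc u} * hgen ?x (n - ?a s)) (?a s + s)))"
    unfolding flagged_det_def flagged_mat_def by (rule det_newton_columns)
  also have "mat n n (\<lambda>(s, u). fps_nth (fps_X ^ u * lin_prod ?x {1..n - Suc u} * hgen ?x (n - ?a s)) (?a s + s))
      = mat n n (\<lambda>(s, u). fps_nth (unimodal_row s) u)"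
  proof (rule cong_mat, goal_cases)
    case (3 s u)
    define a where "a = ?a s"
    have a: "a \<le> s" by (simp add: a_def)
    have "fps_nth (fps_X ^ u * (lin_prod ?x {1..n - Suc u} * hgen ?x (n - a))) (a + s) = fps_nth (unimodal_row s) u"
    proof (cases "u < a")
      case True
      then have "lin_prod ?x {1..n - Suc u} * hgen ?x (n - a) = lin_prod ?x {Suc (n - a)..n - Suc u}"
        by (intro lin_prod_hgen_ge) auto
      moreover have "fps_nth (fps_X ^ u * lin_prod ?x {Suc (n - a)..n - Suc u}) (a + s) = 0"
        using True 3 a by (auto simp: fps_X_power_mult_nth lin_prod_nth_eq_0)
      ultimately show ?thesis
        using True by (simp add: unimodal_row_def fps_X_power_mult_nth flip: a_def)
    next
      case False
      then have "lin_prod ?x {1..n - Suc u} * hgen ?x (n - a) = (\<Prod>i = Suc (n - Suc u)..n - a. geo (?x i))"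
        by (intro lin_prod_hgen_le) auto
      also have "\<dots> = geo 1 ^ Suc (u - a)"
        using 3 False a by (simp add: Suc_diff_Suc Suc_diff_le del: power_Suc)
      finally have *: "lin_prod ?x {1..n - Suc u} * hgen ?x (n - a) = geo 1 ^ Suc (u - a)" .
      have "fps_nth (fps_X ^ u * geo (1 :: rat) ^ Suc (u - a)) (a + s) = of_nat (s choose (u - a))"
        unfolding fps_X_power_mult_nth geo_one_power_nth using False by (auto simp: binomial_eq_0)
      then show ?thesis
        unfolding * using False
        by (simp add: unimodal_row_def fps_X_power_mult_nth binomial_gbinomial flip: a_def)
    qed
    then show ?case by (simp add: mult.assoc a_def)
  qed auto
  finally show ?thesis .
qed

text \<open>The coefficient of \<open>t\<^sup>m\<close> in \<open>unimodal_row s / (1 + t)\<^sup>2\<^sup>m\<^sup>+\<^sup>1\<close>.\<close>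

definition twisted_row :: "nat \<Rightarrow> nat \<Rightarrow> rat" where
  "twisted_row s m = (if s - s div 2 \<le> m then (of_nat s - (2 * of_nat m + 1)) gchoose (m - (s - s div 2)) else 0)"

text \<open>The functionals \<open>f \<mapsto> [t\<^sup>m] f / (1 + t)\<^sup>2\<^sup>m\<^sup>+\<^sup>1\<close> arise from the coefficient functionals by a
  unitriangular change of basis. They are adapted to \<open>y = t (1 + t)\<^sup>2\<close>: multiplication of \<open>f\<close> by \<open>y\<close>
  shifts \<open>m\<close> by one, and \<open>unimodal_row (s + 2) = y * unimodal_row s\<close>.\<close>

lemma det_unimodal_row:
  "det (mat n n (\<lambda>(s, u). fps_nth (unimodal_row s) u)) = det (mat n n (\<lambda>(s, m). twisted_row s m))"
    (is "det ?A = det ?B")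
proof -
  let ?g = "\<lambda>m::nat. fps_binomial (- (2 * of_nat m + 1)) :: rat fps"
  let ?T = "mat n n (\<lambda>(u, m). if u \<le> m then fps_nth (?g m) (m - u) else 0)"
  have "?B = ?A * ?T"
  proof (rule eq_matI)
    fix s m assume "s < dim_row (?A * ?T)" "m < dim_col (?A * ?T)"
    then have sm: "s < n" "m < n" by auto
    have "twisted_row s m = fps_nth (unimodal_row s * ?g m) m"
      unfolding unimodal_row_def twisted_row_def mult.assoc fps_binomial_add_mult[symmetric] add_uminus_conv_diff
      by (simp add: fps_X_power_mult_nth)
    also have "\<dots> = (\<Sum>u = 0..m. fps_nth (unimodal_row s) u * fps_nth (?g m) (m - u))"
      by (rule fps_mult_nth)
    also have "\<dots> = (\<Sum>u<n. fps_nth (unimodal_row s) u * (if u \<le> m then fps_nth (?g m) (m - u) else 0))"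
      using sm by (intro sum.mono_neutral_cong_left) auto
    finally show "?B $$ (s, m) = (?A * ?T) $$ (s, m)"
      using sm by (simp add: scalar_prod_def atLeast0LessThan)
  qed auto
  moreover have "det ?T = prod_list (diag_mat ?T)"
    by (rule det_upper_triangular[of _ n]) auto
  then have "det ?T = 1"
    by (simp add: prod_list_diag_prod)
  ultimately show ?thesis
    using det_mult[of ?A n ?T] by simp
qed

lemma twisted_row_shift: "twisted_row (s + 2) m = (if m = 0 then 0 else twisted_row s (m - 1))"
proof -
  have 1: "s + 2 - (s + 2) div 2 = Suc (s - s div 2)" by simp
  show ?thesis
  proof (cases m)
    case 0
    then show ?thesis by (simp only: twisted_row_def 1) simp
  next
    case (Suc j)
    have 2: "of_nat (s + 2) - (2 * of_nat (Suc j) + 1) = (of_nat s - (2 * of_nat j + 1) :: rat)"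
      by simp
    show ?thesis by (simp only: twisted_row_def 1 2 Suc) simp
  qed
qed

section \<open>Contiguous hypergeometric series\<close>

text \<open>The coefficient of \<open>y\<^sup>j\<close> in the hypergeometric series \<open>\<^sub>2F\<^sub>1(a, b; c; - 27 y / 4)\<close>.\<close>

definition hypergeo_coeff :: "rat \<Rightarrow> rat \<Rightarrow> rat \<Rightarrow> nat \<Rightarrow> rat" where
  "hypergeo_coeff a b c j = (- 27 / 4) ^ j * pochhammer a j * pochhammer b j / (pochhammer c j * fact j)"

lemma hypergeo_coeff_0 [simp]: "hypergeo_coeff a b c 0 = 1"
  by (simp add: hypergeo_coeff_def)

lemma hypergeo_coeff_commute: "hypergeo_coeff a b c j = hypergeo_coeff b a c j"
  by (simp add: hypergeo_coeff_def)

lemma pochhammer_nonzero: "(c::rat) > 0 \<Longrightarrow> pochhammer c j \<noteq> 0"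
  using pochhammer_pos[of c j] by simp

text \<open>The contiguous relation of Gauss between \<open>\<^sub>2F\<^sub>1(a, b; c)\<close>, \<open>\<^sub>2F\<^sub>1(a, b + 1; c + 1)\<close> and
  \<open>\<^sub>2F\<^sub>1(a + 1, b + 1; c + 2)\<close>, coefficient by coefficient.\<close>

lemma hypergeo_coeff_contiguous:
  assumes c: "c > 0"
  shows "hypergeo_coeff a (b + 1) (c + 1) (Suc j) - hypergeo_coeff a b c (Suc j)
    = (- 27 / 4) * (a * (c - b) / (c * (c + 1))) * hypergeo_coeff (a + 1) (b + 1) (c + 2) j"
proof -
  define A B C F Z :: rat where "A = pochhammer (a + 1) j" and "B = pochhammer (b + 1) j"
    and "C = pochhammer (c + 2) j" and "F = fact j" and "Z = (- 27 / 4) ^ j"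
  define J :: rat where "J = of_nat j"
  have nz: "C \<noteq> 0" "F \<noteq> 0" "c \<noteq> 0" "c + 1 \<noteq> 0" "J + 1 \<noteq> 0" "c + 1 + J \<noteq> 0"
    using c pochhammer_nonzero[of "c + 2" j] by (auto simp: C_def F_def J_def add_eq_0_iff)
  have p: "pochhammer a (Suc j) = a * A" "pochhammer b (Suc j) = b * B"
    "pochhammer (b + 1) (Suc j) = (b + 1 + J) * B"
    unfolding A_def B_def J_def by (rule pochhammer_rec pochhammer_rec')+
  have q: "pochhammer (c + 1) (Suc j) = (c + 1) * C"
    by (simp add: C_def pochhammer_rec add.assoc)
  have "pochhammer c (Suc j) * (c + 1 + J) = c * pochhammer (c + 1) (Suc j)"
    unfolding pochhammer_rec[of c] pochhammer_rec'[of "c + 1"] J_def by (simp only: mult_ac)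
  then have "pochhammer c (Suc j) * (c + 1 + J) = c * (c + 1) * C"
    by (simp only: q mult.assoc)
  then have r: "pochhammer c (Suc j) = c * (c + 1) * C / (c + 1 + J)"
    by (simp only: nonzero_eq_divide_eq[OF nz(6)])
  have f: "fact (Suc j) = (J + 1) * F"
    by (simp add: F_def J_def)
  have z: "(- 27 / 4 :: rat) ^ Suc j = (- 27 / 4) * Z"
    by (simp add: Z_def)
  have "hypergeo_coeff a (b + 1) (c + 1) (Suc j) - hypergeo_coeff a b c (Suc j)
     = (- 27 / 4) * Z * a * A * B / (C * F) * (((b + 1 + J) * c - b * (c + 1 + J)) / (c * (c + 1) * (J + 1)))"
  proof -
    \<comment> \<open>Opaque names keep the sums from being multiplied out.\<close>
    define E G K where "E = c + 1" and "G = E + J" and "K = J + 1"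
    define W where "W = (- 27 / 4) * Z * a * A * B / (C * F)"
    have EGK: "E \<noteq> 0" "G \<noteq> 0" "K \<noteq> 0" using nz by (simp_all add: E_def G_def K_def)
    have "hypergeo_coeff a (b + 1) (c + 1) (Suc j) = W * ((b + 1 + J) / (E * K))"
      unfolding hypergeo_coeff_def p q f z unfolding E_def[symmetric] K_def[symmetric] W_def by (simp add: mult_ac)
    also have "(b + 1 + J) / (E * K) = (b + 1 + J) * c / (c * E * K)"
      using nz by simp
    finally have 1: "hypergeo_coeff a (b + 1) (c + 1) (Suc j) = W * ((b + 1 + J) * c / (c * E * K))" .
    have 2: "hypergeo_coeff a b c (Suc j) = W * (b * G / (c * E * K))"
      unfolding hypergeo_coeff_def p r f z unfolding E_def[symmetric] unfolding G_def[symmetric] K_def[symmetric] W_def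
      by (simp add: mult_ac)
    show ?thesis
      unfolding 1 2 unfolding E_def[symmetric] unfolding G_def[symmetric] K_def[symmetric] W_def[symmetric]
      by (simp only: right_diff_distrib diff_divide_distrib)
  qed
  also have "(b + 1 + J) * c - b * (c + 1 + J) = (c - b) * (J + 1)"
    by (simp add: algebra_simps)
  also have "(- 27 / 4) * Z * a * A * B / (C * F) * ((c - b) * (J + 1) / (c * (c + 1) * (J + 1)))
      = (- 27 / 4) * (a * (c - b) / (c * (c + 1))) * hypergeo_coeff (a + 1) (b + 1) (c + 2) j"
    unfolding hypergeo_coeff_def A_def[symmetric] B_def[symmetric] C_def[symmetric] F_def[symmetric] Z_def[symmetric]
    using nz by (simp add: mult_ac)
  finally show ?thesis .
qed

text \<open>The parameters of the sequence of series \<open>F\<^sub>0 = \<^sub>2F\<^sub>1(2/3, 1/3; 1/2)\<close>,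
  \<open>F\<^sub>1 = \<^sub>2F\<^sub>1(4/3, 2/3; 3/2)\<close>, \<open>F\<^sub>2 = \<^sub>2F\<^sub>1(5/3, 4/3; 5/2)\<close>, \<dots>, in which each step adds one to the second
  and the third parameter and then exchanges the first two. Any three consecutive members are
  related by the contiguous relation.\<close>

definition param_a :: "nat \<Rightarrow> rat" where
  "param_a i = (if even i then 2 / 3 else 5 / 6) + of_nat i / 2"

definition param_b :: "nat \<Rightarrow> rat" where
  "param_b i = (if even i then 1 / 3 else 1 / 6) + of_nat i / 2"

definition param_c :: "nat \<Rightarrow> rat" where
  "param_c i = 1 / 2 + of_nat i"

text \<open>The coefficient of \<open>y\<^sup>m\<close> in \<open>y\<^sup>i F\<^sub>i\<close>.\<close>

definition hypergeo_row :: "nat \<Rightarrow> nat \<Rightarrow> rat" where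
  "hypergeo_row i m = (if m < i then 0 else hypergeo_coeff (param_a i) (param_b i) (param_c i) (m - i))"

text \<open>The constant in the relation \<open>F\<^sub>i\<^sub>+\<^sub>1 - F\<^sub>i = contig i * y * F\<^sub>i\<^sub>+\<^sub>2\<close>.\<close>

definition contig :: "nat \<Rightarrow> rat" where
  "contig i = (- 27 / 4) * (param_a i * (param_c i - param_b i) / (param_c i * (param_c i + 1)))"

lemma contig_nonzero: "contig i \<noteq> 0"
proof -
  have "param_a i > 0" "param_c i > 0" "param_c i - param_b i > 0"
    by (auto simp: param_a_def param_b_def param_c_def add_pos_nonneg)
  then show ?thesis by (simp add: contig_def)
qed

lemma hypergeo_row_rec:
  "hypergeo_row (i + 2) m = (hypergeo_row (i + 1) m - (if m = 0 then 0 else hypergeo_row i (m - 1))) / contig i"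
proof -
  have par: "param_a (Suc i) = param_b i + 1" "param_b (Suc i) = param_a i" "param_c (Suc i) = param_c i + 1"
    "param_a (Suc (Suc i)) = param_a i + 1" "param_b (Suc (Suc i)) = param_b i + 1" "param_c (Suc (Suc i)) = param_c i + 2"
    by (auto simp: param_a_def param_b_def param_c_def field_simps)
  consider "m < i + 1" | "m = i + 1" | j where "m = i + 2 + j"
    using le_Suc_ex[of "i + 2" m] by force
  then show ?thesis
  proof cases
    case 3
    have c: "param_c i > 0" by (simp add: param_c_def add_pos_nonneg)
    have "hypergeo_row (i + 1) m - hypergeo_row i (m - 1) = contig i * hypergeo_row (i + 2) m"
      using hypergeo_coeff_contiguous[OF c, of "param_a i" "param_b i" j]
      unfolding 3 contig_def
      by (simp add: hypergeo_row_def par hypergeo_coeff_commute[of "param_b i + 1" "param_a i"])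
    then show ?thesis using contig_nonzero[of i] 3 by (simp add: field_simps)
  qed (auto simp: hypergeo_row_def)
qed

lemma fact_triple: "fact (3 * m) = (27 ^ m * pochhammer (1 / 3) m * pochhammer (2 / 3) m * fact m :: rat)"
proof (induction m)
  case (Suc m)
  have "fact (3 * Suc m) = (of_nat (3 * m) + 3) * (of_nat (3 * m) + 2) * (of_nat (3 * m) + 1) * (fact (3 * m) :: rat)"
    by (simp add: numeral_3_eq_3 algebra_simps)
  then show ?case
    unfolding Suc by (simp add: pochhammer_rec' field_simps)
qed simp

text \<open>The first two rows, \<open>((- 2 m - 1) gchoose m)\<close> and \<open>((- 2 m) gchoose (m - 1))\<close>, are the coefficients
  of \<open>F\<^sub>0\<close> and \<open>y F\<^sub>1\<close>.\<close>

lemma twisted_row_0: "twisted_row 0 m = hypergeo_row 0 m"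
proof -
  have "fact (3 * m) = fact (2 * m) * pochhammer (2 * of_nat m + 1 :: rat) m"
    using pochhammer_product'[of "1 :: rat" "2 * m" m] by (simp add: pochhammer_fact add.commute)
  then have p: "pochhammer (2 * of_nat m + 1 :: rat) m = fact (3 * m) / fact (2 * m)"
    by simp
  have nz: "pochhammer (1 / 2 :: rat) m \<noteq> 0" by (rule pochhammer_nonzero) simp
  have z: "(- 27 / 4 :: rat) ^ m = (-1) ^ m * 27 ^ m / 4 ^ m"
    by (simp flip: power_mult_distrib power_divide)
  have two: "(2 :: rat) ^ (2 * m) = 4 ^ m"
    by (simp add: power_mult)
  have t: "twisted_row 0 m = (-1) ^ m * pochhammer (2 * of_nat m + 1) m / fact m"
    by (simp add: twisted_row_def gbinomial_pochhammer add.commute)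
  have h: "hypergeo_row 0 m = hypergeo_coeff (2 / 3) (1 / 3) (1 / 2) m"
    by (simp add: hypergeo_row_def param_a_def param_b_def param_c_def)
  show ?thesis
    unfolding t h p fact_triple fact_double two hypergeo_coeff_def z
    using nz by (simp add: divide_simps)
qed

lemma twisted_row_1: "twisted_row 1 m = hypergeo_row 1 m"
proof (cases m)
  case 0
  then show ?thesis by (simp add: twisted_row_def hypergeo_row_def)
next
  case (Suc j)
  have "fact (3 * j + 1) = fact (2 * j + 1) * pochhammer (2 * of_nat j + 2 :: rat) j"
    using pochhammer_product'[of "1 :: rat" "2 * j + 1" j] by (simp add: pochhammer_fact add_ac)
  then have "pochhammer (2 * of_nat j + 2 :: rat) j = fact (3 * j + 1) / fact (2 * j + 1)"
    by simp
  then have p: "pochhammer (2 * of_nat j + 2 :: rat) j = (3 * of_nat j + 1) * fact (3 * j) / ((2 * of_nat j + 1) * fact (2 * j))"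
    by (simp add: add_ac)
  have nz: "pochhammer (1 / 2 :: rat) j \<noteq> 0" by (rule pochhammer_nonzero) simp
  have q: "pochhammer (4 / 3 :: rat) j = (3 * of_nat j + 1) * pochhammer (1 / 3) j"
    using pochhammer_rec[of "1 / 3 :: rat" j] pochhammer_rec'[of "1 / 3 :: rat" j] by (simp add: field_simps)
  have r: "pochhammer (3 / 2 :: rat) j = (2 * of_nat j + 1) * pochhammer (1 / 2) j"
    using pochhammer_rec[of "1 / 2 :: rat" j] pochhammer_rec'[of "1 / 2 :: rat" j] by (simp add: field_simps)
  have J: "2 * of_nat j + 1 \<noteq> (0 :: rat)"
    by (metis of_nat_1 of_nat_add of_nat_eq_0_iff of_nat_mult of_nat_numeral add_is_0 one_neq_zero)
  have z: "(- 27 / 4 :: rat) ^ j = (-1) ^ j * 27 ^ j / 4 ^ j"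
    by (simp flip: power_mult_distrib power_divide)
  have two: "(2 :: rat) ^ (2 * j) = 4 ^ j"
    by (simp add: power_mult)
  have t: "twisted_row 1 m = (-1) ^ j * pochhammer (2 * of_nat j + 2) j / fact j"
    by (simp add: Suc twisted_row_def gbinomial_pochhammer)
  have h: "hypergeo_row 1 m = hypergeo_coeff (4 / 3) (2 / 3) (3 / 2) j"
    by (simp add: Suc hypergeo_row_def param_a_def param_b_def param_c_def)
  show ?thesis
    unfolding t h p fact_triple fact_double two hypergeo_coeff_def z q r
    using nz J by (simp add: divide_simps)
qed

section \<open>Triangular decomposition and pivots\<close>

text \<open>The lower triangular matrix of row operations that takes the rows \<open>twisted_row s\<close> to the
  upper unitriangular rows \<open>hypergeo_row i\<close>. The index shift by two is multiplication by \<open>y\<close>, so the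
  recursion is that of \<open>y\<^sup>i F\<^sub>i\<close>.\<close>

fun row_op :: "nat \<Rightarrow> nat \<Rightarrow> rat" where
  "row_op 0 s = (if s = 0 then 1 else 0)"
| "row_op (Suc 0) s = (if s = 1 then 1 else 0)"
| "row_op (Suc (Suc i)) s = (row_op (Suc i) s - (if s < 2 then 0 else row_op i (s - 2))) / contig i"

text \<open>The inverses of the diagonal entries of \<open>row_op\<close>.\<close>

fun pivot :: "nat \<Rightarrow> rat" where
  "pivot 0 = 1"
| "pivot (Suc 0) = 1"
| "pivot (Suc (Suc i)) = - contig i * pivot i"

lemma row_op_eq_0: "i < s \<Longrightarrow> row_op i s = 0"
  by (induction i s rule: row_op.induct) auto

lemma row_op_diag: "row_op i i * pivot i = 1"
proof (induction i rule: pivot.induct)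
  case (3 i)
  then show ?case
    using contig_nonzero[of i] by (simp add: row_op_eq_0)
qed auto

lemma sum_row_op: "(\<Sum>s\<le>i. row_op i s * twisted_row s m) = hypergeo_row i m"
proof (induction i arbitrary: m rule: induct_nat_012)
  case 0
  then show ?case by (simp add: twisted_row_0)
next
  case 1
  then show ?case using twisted_row_1[of m] by simp
next
  case (ge2 i)
  have "(\<Sum>s\<le>Suc (Suc i). row_op (Suc (Suc i)) s * twisted_row s m)
     = ((\<Sum>s\<le>Suc (Suc i). row_op (Suc i) s * twisted_row s m)
       - (\<Sum>s\<le>Suc (Suc i). (if s < 2 then 0 else row_op i (s - 2)) * twisted_row s m)) / contig i"
    by (simp only: row_op.simps sum_subtractf[symmetric] sum_divide_distrib left_diff_distrib times_divide_eq_left)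
  also have "(\<Sum>s\<le>Suc (Suc i). row_op (Suc i) s * twisted_row s m) = hypergeo_row (Suc i) m"
    using ge2(2) by (simp add: row_op_eq_0)
  also have "(\<Sum>s\<le>Suc (Suc i). (if s < 2 then 0 else row_op i (s - 2)) * twisted_row s m)
      = (\<Sum>s\<le>i. row_op i s * twisted_row (s + 2) m)"
    by (simp only: sum.atMost_Suc_shift) simp
  also have "\<dots> = (if m = 0 then 0 else hypergeo_row i (m - 1))"
    unfolding twisted_row_shift using ge2(1) by simp
  finally show ?case
    using hypergeo_row_rec[of i m] by simp
qed

lemma det_twisted_row: "det (mat n n (\<lambda>(s, m). twisted_row s m)) = (\<Prod>i<n. pivot i)"
proof -
  let ?Z = "mat n n (\<lambda>(s, m). twisted_row s m)"
  let ?L = "mat n n (\<lambda>(i, s). row_op i s)"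
  let ?E = "mat n n (\<lambda>(i, m). hypergeo_row i m)"
  have "?E = ?L * ?Z"
  proof (rule eq_matI)
    fix i m assume "i < dim_row (?L * ?Z)" "m < dim_col (?L * ?Z)"
    then have im: "i < n" "m < n" by auto
    have "hypergeo_row i m = (\<Sum>s<n. row_op i s * twisted_row s m)"
      unfolding sum_row_op[symmetric] using im by (intro sum.mono_neutral_left) (auto simp: row_op_eq_0)
    then show "?E $$ (i, m) = (?L * ?Z) $$ (i, m)"
      using im by (simp add: scalar_prod_def atLeast0LessThan)
  qed auto
  then have "det ?E = det ?L * det ?Z"
    using det_mult[of ?L n ?Z] by simp
  moreover have "det ?E = prod_list (diag_mat ?E)"
    by (rule det_upper_triangular[of _ n]) (auto simp: hypergeo_row_def)
  then have "det ?E = 1"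
    by (simp add: prod_list_diag_prod hypergeo_row_def)
  moreover have "det ?L = prod_list (diag_mat ?L)"
    by (rule det_lower_triangular[of n]) (auto simp: row_op_eq_0)
  then have "det ?L = (\<Prod>i<n. row_op i i)"
    by (simp add: prod_list_diag_prod atLeast0LessThan)
  ultimately have Z: "(\<Prod>i<n. row_op i i) * det ?Z = 1" by simp
  have P: "(\<Prod>i<n. row_op i i) * (\<Prod>i<n. pivot i) = 1"
    by (simp add: row_op_diag flip: prod.distrib)
  then have "(\<Prod>i<n. row_op i i) \<noteq> 0"
    by (metis mult_zero_left zero_neq_one)
  then show ?thesis
    using trans[OF Z P[symmetric]] by (simp only: mult_cancel_left) simp
qed

section \<open>The product formulas\<close>

text \<open>The factors of the two product formulas, also for \<open>j = 0\<close>, where both are \<open>1\<close>. Products of two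
  consecutive pivots give one of them each.\<close>

definition CSTCPP_factor :: "nat \<Rightarrow> rat" where
  "CSTCPP_factor j = (of_nat (3 * j + 1) * fact (6 * j) * fact (2 * j)) / (fact (4 * j + 1) * fact (4 * j))"

definition VSASM_factor :: "nat \<Rightarrow> rat" where
  "VSASM_factor j = (of_nat (3 * j + 2) * fact (6 * j + 3) * fact (2 * j + 1)) / (fact (4 * j + 2) * fact (4 * j + 3))"

lemma contig_even:
  "contig (2 * j) = - ((3 * of_nat j + 2) * (6 * of_nat j + 1) * 3 / ((4 * of_nat j + 1) * (4 * of_nat j + 3) * 2))"
proof -
  define x :: rat where "x = of_nat j"
  have x: "x \<ge> 0" by (simp add: x_def)
  have "contig (2 * j) = - 27 / 4 * ((2 / 3 + x) * (1 / 6 + x) / ((1 / 2 + 2 * x) * (3 / 2 + 2 * x)))"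
    by (simp add: contig_def param_a_def param_b_def param_c_def x_def algebra_simps)
  also have "\<dots> = - ((3 * x + 2) * (6 * x + 1) * 3 / ((4 * x + 1) * (4 * x + 3) * 2))"
    using x by (simp add: divide_simps add_nonneg_eq_0_iff) (simp add: algebra_simps)
  finally show ?thesis by (simp add: x_def)
qed

lemma contig_odd:
  "contig (2 * j + 1) = - ((3 * of_nat j + 4) * (6 * of_nat j + 5) * 3 / ((4 * of_nat j + 3) * (4 * of_nat j + 5) * 2))"
proof -
  define x :: rat where "x = of_nat j"
  have x: "x \<ge> 0" by (simp add: x_def)
  have "contig (2 * j + 1) = - 27 / 4 * ((4 / 3 + x) * (5 / 6 + x) / ((3 / 2 + 2 * x) * (5 / 2 + 2 * x)))"
    by (simp add: contig_def param_a_def param_b_def param_c_def x_def algebra_simps add_divide_distrib)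
  also have "\<dots> = - ((3 * x + 4) * (6 * x + 5) * 3 / ((4 * x + 3) * (4 * x + 5) * 2))"
    using x by (simp add: divide_simps add_nonneg_eq_0_iff) (simp add: algebra_simps)
  finally show ?thesis by (simp add: x_def)
qed

lemma fact_plus_2: "fact (n + 2) = (of_nat n + 2) * (of_nat n + 1) * (fact n :: rat)"
  by (simp add: eval_nat_numeral algebra_simps)

lemma fact_plus_4: "fact (n + 4) = (of_nat n + 4) * (of_nat n + 3) * (of_nat n + 2) * (of_nat n + 1) * (fact n :: rat)"
proof -
  have e: "n + 4 = (n + 2) + 2" by simp
  show ?thesis
    unfolding e fact_plus_2[of "n + 2"] fact_plus_2[of n] of_nat_add of_nat_numeral
    by (simp add: add.assoc mult.assoc)
qed

lemma fact_plus_6: "fact (n + 6) = (of_nat n + 6) * (of_nat n + 5) * (of_nat n + 4) * (of_nat n + 3)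
    * (of_nat n + 2) * (of_nat n + 1) * (fact n :: rat)"
proof -
  have e: "n + 6 = (n + 2) + 4" by simp
  show ?thesis
    unfolding e fact_plus_4[of "n + 2"] fact_plus_2[of n] of_nat_add of_nat_numeral
    by (simp add: add.assoc mult.assoc)
qed

lemma CSTCPP_factor_Suc: "CSTCPP_factor (Suc j) = contig (2 * j) * contig (2 * j + 1) * CSTCPP_factor j"
proof -
  define x :: rat where "x = of_nat j"
  have x: "x \<ge> 0" by (simp add: x_def)
  \<comment> \<open>The linear factors are named, so that the quotients cancel factor by factor.\<close>
  define u v p q d e f where "u = x + 1" and "v = 2 * x + 1" and "p = 3 * x + 1" and "q = 3 * x + 2"
    and "d = 4 * x + 1" and "e = 4 * x + 3" and "f = 4 * x + 5"
  note defs = u_def v_def p_def q_def d_def e_def f_def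
  have nz: "u \<noteq> 0" "v \<noteq> 0" "p \<noteq> 0" "q \<noteq> 0" "d \<noteq> 0" "e \<noteq> 0" "f \<noteq> 0"
    using x by (auto simp: defs)
  have f6: "fact (6 * Suc j) = 6 * u * (6 * x + 5) * (2 * q) * (3 * v) * (2 * p) * (6 * x + 1) * (fact (6 * j) :: rat)"
    using fact_plus_6[of "6 * j"] by (simp add: add.commute x_def defs distrib_left mult_ac)
  have f2: "fact (2 * Suc j) = 2 * u * v * (fact (2 * j) :: rat)"
    using fact_plus_2[of "2 * j"] by (simp add: add.commute x_def defs distrib_left mult_ac)
  have f4: "fact (4 * Suc j) = 4 * u * e * (2 * v) * d * (fact (4 * j) :: rat)"
    using fact_plus_4[of "4 * j"] by (simp add: add.commute x_def defs distrib_left mult_ac)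
  have f5: "fact (4 * Suc j + 1) = f * (4 * u) * e * (2 * v) * (fact (4 * j + 1) :: rat)"
    using fact_plus_4[of "4 * j + 1"] by (simp add: add.commute x_def defs distrib_left mult_ac del: fact_Suc)
  have c: "contig (2 * j) * contig (2 * j + 1) = q * (6 * x + 1) * (3 * x + 4) * (6 * x + 5) * 9 / (d * e * e * f * 4)"
    unfolding contig_even contig_odd x_def[symmetric] by (simp add: defs mult_ac)
  have o: "of_nat (3 * Suc j + 1) = 3 * x + 4" "of_nat (3 * j + 1) = p"
    by (simp_all add: x_def defs)
  show ?thesis
    unfolding CSTCPP_factor_def f6 f2 f4 f5 c o using nz by (simp add: divide_simps)
qed

lemma VSASM_factor_Suc: "VSASM_factor (Suc j) = contig (2 * j + 1) * contig (2 * Suc j) * VSASM_factor j"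
proof -
  define x :: rat where "x = of_nat j"
  have x: "x \<ge> 0" by (simp add: x_def)
  \<comment> \<open>The linear factors are named, so that the quotients cancel factor by factor.\<close>
  define u w q r d e f where "u = x + 1" and "w = 2 * x + 3" and "q = 3 * x + 2" and "r = 3 * x + 4"
    and "d = 4 * x + 3" and "e = 4 * x + 5" and "f = 4 * x + 7"
  note defs = u_def w_def q_def r_def d_def e_def f_def
  have nz: "u \<noteq> 0" "w \<noteq> 0" "q \<noteq> 0" "r \<noteq> 0" "d \<noteq> 0" "e \<noteq> 0" "f \<noteq> 0"
    using x by (auto simp: defs)
  have f9: "fact (6 * Suc j + 3) = 3 * w * (2 * r) * (6 * x + 7) * (6 * u) * (6 * x + 5) * (2 * q) * (fact (6 * j + 3) :: rat)"
    using fact_plus_6[of "6 * j + 3"] by (simp add: add.commute x_def defs distrib_left mult_ac)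
  have f3: "fact (2 * Suc j + 1) = w * (2 * u) * (fact (2 * j + 1) :: rat)"
    using fact_plus_2[of "2 * j + 1"] by (simp add: add.commute x_def defs distrib_left mult_ac del: fact_Suc)
  have f6: "fact (4 * Suc j + 2) = 2 * w * e * (4 * u) * d * (fact (4 * j + 2) :: rat)"
    using fact_plus_4[of "4 * j + 2"] by (simp add: add.commute x_def defs distrib_left mult_ac)
  have f7: "fact (4 * Suc j + 3) = f * (2 * w) * e * (4 * u) * (fact (4 * j + 3) :: rat)"
    using fact_plus_4[of "4 * j + 3"] by (simp add: add.commute x_def defs distrib_left mult_ac)
  have c: "contig (2 * j + 1) * contig (2 * Suc j) = r * (6 * x + 5) * (3 * x + 5) * (6 * x + 7) * 9 / (d * e * e * f * 4)"
    unfolding contig_even contig_odd of_nat_Suc x_def[symmetric] by (simp add: defs algebra_simps)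
  have o: "of_nat (3 * Suc j + 2) = 3 * x + 5" "of_nat (3 * j + 2) = q"
    by (simp_all add: x_def defs)
  show ?thesis
    unfolding VSASM_factor_def f9 f3 f6 f7 c o using nz by (simp add: divide_simps)
qed

lemma pivot_pair_even: "pivot (2 * j) * pivot (2 * j + 1) = CSTCPP_factor j"
proof (induction j)
  case 0
  then show ?case by (simp add: CSTCPP_factor_def)
next
  case (Suc j)
  then show ?case by (simp add: CSTCPP_factor_Suc)
qed

lemma pivot_pair_odd: "pivot (2 * j + 1) * pivot (2 * j + 2) = VSASM_factor j"
proof (induction j)
  case 0
  have "pivot 2 = - contig 0"
    using pivot.simps(3)[of 0] by (simp add: numeral_2_eq_2)
  then show ?case using contig_even[of 0] by (simp add: VSASM_factor_def fact_numeral)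
next
  case (Suc j)
  show ?case by (simp add: VSASM_factor_Suc Suc[symmetric] mult_ac)
qed

lemma prod_pivot_even:
  assumes k: "k \<ge> 1"
  shows "(\<Prod>i<2 * k. pivot i) = CSTCPP k"
proof -
  have "(\<Prod>i<2 * k. pivot i) = (\<Prod>j<k. CSTCPP_factor j)"
    by (induction k) (simp_all add: mult.assoc flip: pivot_pair_even)
  also have "\<dots> = CSTCPP_factor 0 * (\<Prod>j = 1..<k. CSTCPP_factor j)"
    using k by (simp add: lessThan_atLeast0 prod.atLeast_Suc_lessThan)
  finally show ?thesis
    by (simp add: CSTCPP_def CSTCPP_factor_def)
qed

lemma prod_pivot_odd:
  assumes k: "k \<ge> 1"
  shows "(\<Prod>i<2 * k + 1. pivot i) = VSASM k"
proof -
  have "(\<Prod>i<2 * k + 1. pivot i) = (\<Prod>j<k. VSASM_factor j)"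
    by (induction k) (simp_all add: mult.assoc flip: pivot_pair_odd)
  also have "\<dots> = VSASM_factor 0 * (\<Prod>j = 1..<k. VSASM_factor j)"
    using k by (simp add: lessThan_atLeast0 prod.atLeast_Suc_lessThan)
  finally show ?thesis
    by (simp add: VSASM_def VSASM_factor_def fact_numeral)
qed

lemma schubert_unimodal_at_one:
  assumes "n \<ge> 1"
  shows "rat_of_int (poly_subst (\<lambda>_. 1) (schubert n (one_line (unimodal_list n)))) = (\<Prod>i<n. pivot i)"
proof -
  have "comm_ring_hom rat_of_int"
    by unfold_locales auto
  from hom_flagged_det[OF this, of "\<lambda>_. 1"] show ?thesis
    by (simp add: poly_subst_schubert_unimodal[OF assms] flagged_det_one det_unimodal_row det_twisted_row)
qed

theorem proposition5p7:
  fixes k :: nat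
  assumes "k \<ge> 1"
  shows "of_int (poly_subst (\<lambda>_. 1) (schubert (2 * k) (w_minus k))) = CSTCPP k \<and>
         of_int (poly_subst (\<lambda>_. 1) (schubert (2 * k + 1) (w_plus k))) = VSASM k"
proof
  have "w_minus k = one_line (unimodal_list (2 * k))"
    by (simp add: w_minus_def unimodal_list_def del: upt_Suc)
  then show "of_int (poly_subst (\<lambda>_. 1) (schubert (2 * k) (w_minus k))) = CSTCPP k"
    using schubert_unimodal_at_one[of "2 * k"] assms by (simp add: prod_pivot_even)
  have "w_plus k = one_line (unimodal_list (2 * k + 1))"
    by (simp add: w_plus_def unimodal_list_def del: upt_Suc)
  then show "of_int (poly_subst (\<lambda>_. 1) (schubert (2 * k + 1) (w_plus k))) = VSASM k"
    using schubert_unimodal_at_one[of "2 * k + 1"] prod_pivot_odd[OF assms] by simp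
qed

end
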